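(* Let $\mathcal{A}$ be a semiprime, complex, unital Banach algebra with $\mathrm{soc}(\mathcal{A})\neq\{0\}$, and let $f\in\mathcal{A}$ satisfy $f^n\in\mathrm{soc}(\mathcal{A})$ for some $n\in\mathbb{N}$. If $x\in\mathcal{A}$ is B-Fredholm and commutes with $f$, then $x+f$ is B-Fredholm. If, additionally, $\mathcal{A}$ is primitive, then $$\mathrm{i}(x+f)=\mathrm{i}(x).$$
   Context: An algebra is semiprime if $\{0\}$ is its only two-sided ideal $J$ with $J^2=\{0\}$; it is primitive if it possesses a faithful irreducible representation (primitive implies semisimple, which implies semiprime). $\mathrm{soc}(\mathcal{A})$ is the sum of all minimal right ideals of $\mathcal{A}$ (equal to the sum of all minimal left ideals), or $\{0\}$ if there are none. An element $a$ of a ring is Drazin invertible if there are $b$ in the ring (the Drazin inverse, which is unique) and $k\in\mathbb{N}$ with $bab=b$, $ab=ba$, $a^kba=a^k$. Let $\pi:\mathcal{A}\to\mathcal{A}/\mathrm{soc}(\mathcal{A})$ be the canonical homomorphism; $a\in\mathcal{A}$ is B-Fredholm if $\pi(a)$ is Drazin invertible. Index (semisimple $\mathcal{A}$): for $a\in\mathrm{soc}(\mathcal{A})$ the trace is $\tau(a)=\sum_{\lambda\in\sigma(a)}\lambda\,m(\lambda,a)$, where $m(\lambda,a)$ is the algebraic multiplicity of $\lambda$ for $a$ in the sense of Aupetit and Mouton; for nonzero $\lambda\in\sigma(a)$ (there are finitely many) it is the rank of the Riesz (spectral) idempotent $p$ of $a$ at $\lambda$, which lies in $\mathrm{soc}(\mathcal{A})$,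 i.e. the smallest number of minimal right ideals of $\mathcal{A}$ whose sum is $p\mathcal{A}$. The index of a B-Fredholm element $a$ is $\mathrm{i}(a)=\tau(aa_0-a_0a)$, where $a_0\in\mathcal{A}$ is any element such that $\pi(a_0)$ is the Drazin inverse of $\pi(a)$; it does not depend on the choice of $a_0$. *)

theory Defs
  imports "HOL-Complex_Analysis.Contour_Integration"
begin

section \<open>Ideals and the socle\<close>

text \<open>
  All rings here have a unit. Closure under multiplication by ring elements therefore includes
  closure under negation and, in a complex unital algebra, under complex scalars, so ring ideals
  and algebra ideals are the same thing.
\<close>

definition right_ideal :: "'a::ring_1 set \<Rightarrow> bool" where
  "right_ideal J \<longleftrightarrow>
     0 \<in> J \<and> (\<forall>x\<in>J. \<forall>y\<in>J. x + y \<in> J) \<and> (\<forall>x\<in>J. \<forall>a. x * a \<in> J)"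

definition two_sided_ideal :: "'a::ring_1 set \<Rightarrow> bool" where
  "two_sided_ideal J \<longleftrightarrow> right_ideal J \<and> (\<forall>x\<in>J. \<forall>a. a * x \<in> J)"

definition minimal_right_ideal :: "'a::ring_1 set \<Rightarrow> bool" where
  "minimal_right_ideal J \<longleftrightarrow>
     right_ideal J \<and> J \<noteq> {0} \<and> (\<forall>K. right_ideal K \<and> K \<subseteq> J \<longrightarrow> K = {0} \<or> K = J)"

text \<open>The sum of a (possibly infinite) family of ideals; it is \<open>{0}\<close> for the empty family.\<close>

definition ideal_sum :: "'a::ring_1 set set \<Rightarrow> 'a set" where
  "ideal_sum \<J> = {(\<Sum>J\<in>F. g J) | F g. finite F \<and> F \<subseteq> \<J> \<and> (\<forall>J\<in>F. g J \<in> J)}"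

definition soc :: "'a::ring_1 set" where
  "soc = ideal_sum {J. minimal_right_ideal J}"

text \<open>\<open>J\<^sup>2 = {0}\<close> says exactly that all products of two elements of \<open>J\<close> vanish.\<close>

definition semiprime :: "'a::ring_1 itself \<Rightarrow> bool" where
  "semiprime _ \<longleftrightarrow>
     (\<forall>J::'a set. two_sided_ideal J \<and> (\<forall>x\<in>J. \<forall>y\<in>J. x * y = 0) \<longrightarrow> J = {0})"

lemma ideal_sum_add:
  assumes "\<And>J. J \<in> \<J> \<Longrightarrow> right_ideal J" "x \<in> ideal_sum \<J>" "y \<in> ideal_sum \<J>"
  shows "x + y \<in> ideal_sum \<J>"
proof -
  obtain F g where F: "finite F" "F \<subseteq> \<J>" "\<forall>J\<in>F. g J \<in> J" "x = (\<Sum>J\<in>F. g J)"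
    using assms(2) unfolding ideal_sum_def by blast
  obtain G h where G: "finite G" "G \<subseteq> \<J>" "\<forall>J\<in>G. h J \<in> J" "y = (\<Sum>J\<in>G. h J)"
    using assms(3) unfolding ideal_sum_def by blast
  define k where "k J = (if J \<in> F then g J else 0) + (if J \<in> G then h J else 0)" for J
  have "x = (\<Sum>J\<in>F \<union> G. if J \<in> F then g J else 0)"
    unfolding F(4) using F(1) G(1) by (intro sum.mono_neutral_cong_left) auto
  moreover have "y = (\<Sum>J\<in>F \<union> G. if J \<in> G then h J else 0)"
    unfolding G(4) using F(1) G(1) by (intro sum.mono_neutral_cong_left) auto
  ultimately have "x + y = (\<Sum>J\<in>F \<union> G. k J)"
    unfolding k_def by (simp add: sum.distrib)
  moreover have "\<forall>J\<in>F \<union> G. k J \<in> J"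
  proof
    fix J assume J: "J \<in> F \<union> G"
    then have J': "0 \<in> J" "\<And>x y. x \<in> J \<Longrightarrow> y \<in> J \<Longrightarrow> x + y \<in> J"
      using F(2) G(2) assms(1)[of J] unfolding right_ideal_def by blast+
    show "k J \<in> J"
      unfolding k_def by (rule J'(2)) (use F(3) G(3) J'(1) in auto)
  qed
  ultimately show ?thesis
    using F(1,2) G(1,2) unfolding ideal_sum_def by blast
qed

lemma ideal_sum_mult_right:
  assumes "\<And>J. J \<in> \<J> \<Longrightarrow> right_ideal J" "x \<in> ideal_sum \<J>"
  shows "x * a \<in> ideal_sum \<J>"
proof -
  obtain F g where F: "finite F" "F \<subseteq> \<J>" "\<forall>J\<in>F. g J \<in> J" "x = (\<Sum>J\<in>F. g J)"
    using assms(2) unfolding ideal_sum_def by blast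
  have "x * a = (\<Sum>J\<in>F. g J * a)" by (simp add: F(4) sum_distrib_right)
  moreover have "\<forall>J\<in>F. g J * a \<in> J"
    using F(2,3) assms(1) unfolding right_ideal_def by blast
  ultimately show ?thesis
    using F(1,2) unfolding ideal_sum_def by (auto intro!: exI[of _ F] exI[of _ "\<lambda>J. g J * a"])
qed

lemma zero_in_ideal_sum: "0 \<in> ideal_sum \<J>"
  unfolding ideal_sum_def by (auto intro!: exI[of _ "{}"])

lemma in_ideal_sum: "J \<in> \<J> \<Longrightarrow> x \<in> J \<Longrightarrow> x \<in> ideal_sum \<J>"
  unfolding ideal_sum_def by (auto intro!: exI[of _ "{J}"] exI[of _ "\<lambda>_. x"])

lemma minimal_right_ideal_left_translate:
  assumes "minimal_right_ideal J" "(\<lambda>x. a * x) ` J \<noteq> {0}"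
  shows "minimal_right_ideal ((\<lambda>x. a * x) ` J)"
proof -
  have J: "right_ideal J" "\<And>K. right_ideal K \<Longrightarrow> K \<subseteq> J \<Longrightarrow> K = {0} \<or> K = J"
    using assms(1) unfolding minimal_right_ideal_def by auto
  have ri: "right_ideal ((\<lambda>x. a * x) ` J)"
    unfolding right_ideal_def
  proof (intro conjI ballI allI)
    show "0 \<in> (\<lambda>x. a * x) ` J"
      using J(1) unfolding right_ideal_def by (auto intro!: image_eqI[of _ _ 0])
  next
    fix u v assume "u \<in> (\<lambda>x. a * x) ` J" "v \<in> (\<lambda>x. a * x) ` J"
    then obtain x y where "x \<in> J" "y \<in> J" "u = a * x" "v = a * y" by blast
    then show "u + v \<in> (\<lambda>x. a * x) ` J"
      using J(1) unfolding right_ideal_def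
      by (auto intro!: image_eqI[of _ _ "x + y"] simp: distrib_left)
  next
    fix u b assume "u \<in> (\<lambda>x. a * x) ` J"
    then obtain x where "x \<in> J" "u = a * x" by blast
    then show "u * b \<in> (\<lambda>x. a * x) ` J"
      using J(1) unfolding right_ideal_def
      by (auto intro!: image_eqI[of _ _ "x * b"] simp: mult.assoc)
  qed
  have "K = {0} \<or> K = (\<lambda>x. a * x) ` J"
    if K: "right_ideal K" "K \<subseteq> (\<lambda>x. a * x) ` J" for K
  proof -
    define L where "L = {x\<in>J. a * x \<in> K}"
    have "right_ideal L"
      using J(1) K(1) unfolding right_ideal_def L_def
      by (simp add: distrib_left mult.assoc [symmetric])
    then have "L = {0} \<or> L = J" using J(2) unfolding L_def by blast
    moreover have "K = (\<lambda>x. a * x) ` L" using K(2) unfolding L_def by auto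
    ultimately show ?thesis by auto
  qed
  then show ?thesis using ri assms(2) unfolding minimal_right_ideal_def by blast
qed

lemma two_sided_ideal_soc: "two_sided_ideal (soc :: 'a::ring_1 set)"
proof -
  have *: "\<And>J::'a set. J \<in> {J. minimal_right_ideal J} \<Longrightarrow> right_ideal J"
    unfolding minimal_right_ideal_def by auto
  have add: "x + y \<in> soc" if "x \<in> soc" "y \<in> soc" for x y :: 'a
    using ideal_sum_add[OF *] that unfolding soc_def by blast
  have right: "x * a \<in> soc" if "x \<in> soc" for x a :: 'a
    using ideal_sum_mult_right[OF *] that unfolding soc_def by blast
  have zero: "(0::'a) \<in> soc" unfolding soc_def by (rule zero_in_ideal_sum)
  have left: "a * x \<in> soc" if x: "x \<in> soc" for a x :: 'a
  proof -
    obtain F g where F: "finite F" "\<forall>J\<in>F. minimal_right_ideal J" "\<forall>J\<in>F. g J \<in> J"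
      "x = (\<Sum>J\<in>F. g J)"
      using x unfolding soc_def ideal_sum_def by blast
    have terms: "a * g J \<in> soc" if "J \<in> F" for J
    proof (cases "(\<lambda>x. a * x) ` J = {0}")
      case True
      then have "a * g J = 0" using F(3) that by blast
      then show ?thesis using zero by simp
    next
      case False
      then have "minimal_right_ideal ((\<lambda>x. a * x) ` J)"
        using minimal_right_ideal_left_translate F(2) that by blast
      then show ?thesis
        unfolding soc_def using F(3) that
        by (intro in_ideal_sum[of "(\<lambda>x. a * x) ` J"]) auto
    qed
    have "(\<Sum>J\<in>F. a * g J) \<in> soc"
      using F(1) terms by (induction F rule: finite_induct) (auto intro: zero add)
    then show ?thesis by (simp add: F(4) sum_distrib_left)
  qed
  show ?thesis
    unfolding two_sided_ideal_def right_ideal_def using zero add right left by blast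
qed

lemma soc_0 [simp]: "0 \<in> soc"
  and soc_add: "x \<in> soc \<Longrightarrow> y \<in> soc \<Longrightarrow> x + y \<in> soc"
  and soc_mult_right: "x \<in> soc \<Longrightarrow> x * a \<in> soc"
  and soc_mult_left: "x \<in> soc \<Longrightarrow> a * x \<in> soc"
  using two_sided_ideal_soc unfolding two_sided_ideal_def right_ideal_def by blast+

lemma soc_minus: "x \<in> soc \<Longrightarrow> - x \<in> soc"
  using soc_mult_right[of x "- 1"] by simp


section \<open>The quotient by the socle\<close>

definition soc_rel :: "'a::ring_1 \<Rightarrow> 'a \<Rightarrow> bool" where
  "soc_rel a b \<longleftrightarrow> a - b \<in> soc"

lemma equivp_soc_rel: "equivp soc_rel"
proof (rule equivpI)
  show "reflp soc_rel" by (simp add: reflp_def soc_rel_def)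
  show "symp soc_rel"
    unfolding symp_def soc_rel_def by (metis minus_diff_eq soc_minus)
  show "transp soc_rel"
    unfolding transp_def soc_rel_def by (metis diff_add_cancel add_diff_eq soc_add)
qed

quotient_type (overloaded) 'a soc_quot = "'a::ring_1" / soc_rel
  morphisms rep_soc_quot soc_proj
  by (rule equivp_soc_rel)

text \<open>
  The quotient is the zero ring if the socle is the whole ring, so it is an instance of
  \<open>ring\<close> and \<open>monoid_mult\<close>, but not of \<open>ring_1\<close>.
\<close>

instantiation soc_quot :: (ring_1) "{ring, monoid_mult}"
begin

lift_definition zero_soc_quot :: "'a soc_quot" is 0 .

lift_definition one_soc_quot :: "'a soc_quot" is 1 .

lift_definition plus_soc_quot :: "'a soc_quot \<Rightarrow> 'a soc_quot \<Rightarrow> 'a soc_quot" is "(+)"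
  unfolding soc_rel_def by (metis add_diff_add soc_add)

lift_definition uminus_soc_quot :: "'a soc_quot \<Rightarrow> 'a soc_quot" is uminus
  unfolding soc_rel_def by (metis minus_diff_minus soc_minus)

lift_definition minus_soc_quot :: "'a soc_quot \<Rightarrow> 'a soc_quot \<Rightarrow> 'a soc_quot" is "(-)"
proof -
  fix a b c d :: 'a assume "soc_rel a b" "soc_rel c d"
  then have "(a - b) + - (c - d) \<in> soc"
    unfolding soc_rel_def by (intro soc_add soc_minus)
  then show "soc_rel (a - c) (b - d)" by (simp add: soc_rel_def algebra_simps)
qed

lift_definition times_soc_quot :: "'a soc_quot \<Rightarrow> 'a soc_quot \<Rightarrow> 'a soc_quot" is "(*)"
proof -
  fix a b c d :: 'a assume "soc_rel a b" "soc_rel c d"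
  then have "(a - b) * c + b * (c - d) \<in> soc"
    unfolding soc_rel_def by (intro soc_add soc_mult_left soc_mult_right)
  then show "soc_rel (a * c) (b * d)" by (simp add: soc_rel_def algebra_simps)
qed

instance
  by standard (transfer, simp add: soc_rel_def algebra_simps)+

end


section \<open>Drazin invertible and B-Fredholm elements\<close>

definition drazin_inverse :: "'r::{ring, monoid_mult} \<Rightarrow> 'r \<Rightarrow> bool" where
  "drazin_inverse a b \<longleftrightarrow>
     b * a * b = b \<and> a * b = b * a \<and> (\<exists>k::nat. a ^ k * b * a = a ^ k)"

definition drazin_invertible :: "'r::{ring, monoid_mult} \<Rightarrow> bool" where
  "drazin_invertible a \<longleftrightarrow> (\<exists>b. drazin_inverse a b)"

definition b_fredholm :: "'a::ring_1 \<Rightarrow> bool" where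
  "b_fredholm a \<longleftrightarrow> drazin_invertible (soc_proj a)"


section \<open>Complex unital Banach algebras\<close>

class complex_banach_algebra_1 = real_normed_algebra_1 + banach +
  fixes scaleC :: "complex \<Rightarrow> 'a \<Rightarrow> 'a" (infixr "*\<^sub>C" 75)
  assumes scaleC_add_right: "c *\<^sub>C (x + y) = c *\<^sub>C x + c *\<^sub>C y"
    and scaleC_add_left: "(c + d) *\<^sub>C x = c *\<^sub>C x + d *\<^sub>C x"
    and scaleC_scaleC: "c *\<^sub>C d *\<^sub>C x = (c * d) *\<^sub>C x"
    and scaleC_of_real: "complex_of_real r *\<^sub>C x = r *\<^sub>R x"
    and mult_scaleC_left: "(c *\<^sub>C x) * y = c *\<^sub>C (x * y)"
    and mult_scaleC_right: "x * (c *\<^sub>C y) = c *\<^sub>C (x * y)"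
    and norm_scaleC: "norm (c *\<^sub>C x) = cmod c * norm x"


section \<open>Primitive algebras\<close>

text \<open>
  Representations are purely algebraic. The representation space is a linear subspace \<open>V\<close>
  of a complex vector space on the type \<open>'v\<close> with scalar multiplication \<open>s\<close>; every
  complex vector space is of this form, and \<open>\<rho> a\<close> is only relevant on \<open>V\<close>.
\<close>

definition representation ::
  "(complex \<Rightarrow> 'v \<Rightarrow> 'v) \<Rightarrow> 'v::ab_group_add set \<Rightarrow>
    ('a::complex_banach_algebra_1 \<Rightarrow> 'v \<Rightarrow> 'v) \<Rightarrow> bool" where
  "representation s V \<rho> \<longleftrightarrow>
     vector_space s \<and> module.subspace s V \<and>
     (\<forall>a. \<forall>v\<in>V. \<rho> a v \<in> V) \<and>
     (\<forall>a. \<forall>v\<in>V. \<forall>w\<in>V. \<rho> a (v + w) = \<rho> a v + \<rho> a w) \<and>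
     (\<forall>a c. \<forall>v\<in>V. \<rho> a (s c v) = s c (\<rho> a v)) \<and>
     (\<forall>a b. \<forall>v\<in>V. \<rho> (a + b) v = \<rho> a v + \<rho> b v) \<and>
     (\<forall>a c. \<forall>v\<in>V. \<rho> (c *\<^sub>C a) v = s c (\<rho> a v)) \<and>
     (\<forall>a b. \<forall>v\<in>V. \<rho> (a * b) v = \<rho> a (\<rho> b v))"

definition faithful_on ::
  "'v set \<Rightarrow> ('a::complex_banach_algebra_1 \<Rightarrow> 'v \<Rightarrow> 'v) \<Rightarrow> bool" where
  "faithful_on V \<rho> \<longleftrightarrow> (\<forall>a b. (\<forall>v\<in>V. \<rho> a v = \<rho> b v) \<longrightarrow> a = b)"

definition irreducible_on ::
  "(complex \<Rightarrow> 'v \<Rightarrow> 'v) \<Rightarrow> 'v::ab_group_add set \<Rightarrow>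
    ('a::complex_banach_algebra_1 \<Rightarrow> 'v \<Rightarrow> 'v) \<Rightarrow> bool" where
  "irreducible_on s V \<rho> \<longleftrightarrow>
     (\<exists>a. \<exists>v\<in>V. \<rho> a v \<noteq> 0) \<and>
     (\<forall>W. module.subspace s W \<and> W \<subseteq> V \<and> (\<forall>a. \<forall>w\<in>W. \<rho> a w \<in> W) \<longrightarrow> W = {0} \<or> W = V)"

text \<open>
  A definition cannot quantify over the type \<open>'v\<close> that carries the representation space, so
  \<open>'v\<close> is a parameter. In a hypothesis with \<open>'v\<close> occurring nowhere else, this amounts
  to an existential quantifier over all representation spaces. The choice \<open>'v = 'a\<close> already
  covers every primitive algebra, since an irreducible representation space is isomorphic to
  the quotient by a maximal left ideal, hence to a linear complement of that ideal.
\<close>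

definition primitive_algebra ::
  "'a::complex_banach_algebra_1 itself \<Rightarrow> 'v::ab_group_add itself \<Rightarrow> bool" where
  "primitive_algebra _ _ \<longleftrightarrow>
     (\<exists>(s :: complex \<Rightarrow> 'v \<Rightarrow> 'v) V (\<rho> :: 'a \<Rightarrow> 'v \<Rightarrow> 'v).
        representation s V \<rho> \<and> faithful_on V \<rho> \<and> irreducible_on s V \<rho>)"


section \<open>Spectrum and Riesz idempotents\<close>

definition is_inverse :: "'a::ring_1 \<Rightarrow> 'a \<Rightarrow> bool" where
  "is_inverse a b \<longleftrightarrow> a * b = 1 \<and> b * a = 1"

definition spectrum :: "'a::complex_banach_algebra_1 \<Rightarrow> complex set" where
  "spectrum a = {z. \<not> (\<exists>b. is_inverse (z *\<^sub>C 1 - a) b)}"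

definition resolvent :: "'a::complex_banach_algebra_1 \<Rightarrow> complex \<Rightarrow> 'a" where
  "resolvent a z = (THE b. is_inverse (z *\<^sub>C 1 - a) b)"

text \<open>The library's \<open>contour_integral\<close> is for complex-valued functions only.\<close>

definition algebra_contour_integral ::
  "(real \<Rightarrow> complex) \<Rightarrow> (complex \<Rightarrow> 'a::complex_banach_algebra_1) \<Rightarrow> 'a" where
  "algebra_contour_integral \<gamma> F =
     integral {0..1} (\<lambda>t. vector_derivative \<gamma> (at t within {0..1}) *\<^sub>C F (\<gamma> t))"

text \<open>
  For an isolated point \<open>z\<close> of the spectrum, the Riesz idempotent is the integral of the
  resolvent over a circle that separates \<open>z\<close> from the rest of the spectrum, divided by
  \<open>2 \<pi> \<i>\<close>. It does not depend on the radius.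
\<close>

definition riesz_radius :: "complex \<Rightarrow> 'a::complex_banach_algebra_1 \<Rightarrow> real" where
  "riesz_radius z a = (SOME r. r > 0 \<and> spectrum a \<inter> cball z r = {z})"

definition riesz_idempotent :: "complex \<Rightarrow> 'a::complex_banach_algebra_1 \<Rightarrow> 'a" where
  "riesz_idempotent z a =
     (1 / (2 * complex_of_real pi * \<i>)) *\<^sub>C
       algebra_contour_integral (circlepath z (riesz_radius z a)) (resolvent a)"


section \<open>Rank, trace and index\<close>

text \<open>
  The following notions are meaningful only in the stated range and are totalized arbitrarily
  outside of it: the rank and the trace for elements of the socle of a semisimple algebra, the
  index for its B-Fredholm elements.
\<close>

definition idempotent_rank :: "'a::ring_1 \<Rightarrow> nat" where
  "idempotent_rank p =
     (LEAST n. \<exists>\<J>. finite \<J> \<and> card \<J> = n \<and> (\<forall>J\<in>\<J>. minimal_right_ideal J) \<and>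
        ideal_sum \<J> = range (\<lambda>x. p * x))"

text \<open>
  The Riesz idempotent at \<open>0\<close> need not lie in the socle, but the multiplicity of \<open>0\<close>
  gets the factor \<open>0\<close> in the trace.
\<close>

definition multiplicity :: "complex \<Rightarrow> 'a::complex_banach_algebra_1 \<Rightarrow> nat" where
  "multiplicity z a = idempotent_rank (riesz_idempotent z a)"

definition trace :: "'a::complex_banach_algebra_1 \<Rightarrow> complex" where
  "trace a = (\<Sum>z\<in>spectrum a. z * of_nat (multiplicity z a))"

definition index :: "'a::complex_banach_algebra_1 \<Rightarrow> complex" where
  "index a =
     (let b = (SOME b. drazin_inverse (soc_proj a) (soc_proj b)) in trace (a * b - b * a))"

end

theory Submission
  imports Defs "HOL-Complex_Analysis.Cauchy_Integral_Formula"
    "HOL-Computational_Algebra.Fundamental_Theorem_Algebra"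
begin

text \<open>
  Modulo the socle, \<open>f\<close> is nilpotent and commutes with \<open>x\<close>. If \<open>y\<close> lifts the Drazin inverse of
  \<open>\<pi>(x)\<close>, the Drazin inverse of \<open>\<pi>(x + f)\<close> is therefore the class of \<open>y g\<close>, where
  \<open>g\<close> is the finite geometric series of \<open>- y f\<close>.

  In the primitive case fix a minimal idempotent \<open>e\<close>. By Gelfand and Mazur \<open>e A e = \<complex> e\<close>, the
  socle consists of the sums \<open>\<Sum> u\<^sub>i e v\<^sub>i\<close>, and \<open>u e v \<mapsto> \<phi> (v u)\<close>, with \<open>e z e = \<phi> z e\<close>,
  is a linear functional \<open>tr\<close> on it with \<open>tr (s a) = tr (a s)\<close>. It vanishes on nilpotents and is the rank on
  idempotents, and elements of the socle are algebraic, so it is the spectral trace. Hence the index is the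
  form \<open>\<tau> g h = tr (g h - h g)\<close> evaluated at \<open>x\<close> and \<open>y\<close>. On elements that commute modulo the socle,
  \<open>\<tau>\<close> is alternating and a derivation in each variable, and this alone yields
  \<open>\<tau> (x + f) (y g) = \<tau> x y\<close>.
\<close>

section \<open>Drazin inverses\<close>

text \<open>The trace in \<open>index\<close> is a sum over the spectrum, so neither its additivity
  nor its vanishing on commutators with an element of the socle can be read off. The functional
  \<open>tr\<close> is built to have both, at the price of a proof of well-definedness, and
  \<open>trace_eq_tr\<close> passes between the two. The contour integrals in the multiplicities
  become scalar ones, since the resolvent of an algebraic element is a rational function with
  coefficients in the algebra. Primitivity enters as primeness: for \<open>x \<noteq> 0\<close> some
  \<open>x * c * e\<close> is nonzero, so one fixed \<open>e\<close> reaches every minimal right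
  ideal and with them the whole socle. Lifts of commuting classes commute only up to the socle, and
  this defect is what the index measures.\<close>

lemma power_mult_commuting:
  fixes a b :: "'r::monoid_mult"
  assumes "a * b = b * a"
  shows "(a * b) ^ n = a ^ n * b ^ n"
proof (induction n)
  case (Suc n)
  have "(a * b) ^ Suc n = a * (b * a ^ n) * b ^ n" using Suc by (simp add: mult.assoc)
  also have "b * a ^ n = a ^ n * b" by (rule power_commuting_commutes[OF assms, symmetric])
  finally show ?case by (simp add: mult.assoc)
qed simp

lemma sum_power_commuting:
  fixes c u :: "'r::{ring, monoid_mult}"
  assumes "c * u = u * c"
  shows "c * (\<Sum>k<N. u ^ k) = (\<Sum>k<N. u ^ k) * c"
  using power_commuting_commutes[OF assms[symmetric]] by (simp add: sum_distrib_left sum_distrib_right)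

lemma one_minus_mult_geometric_sum:
  fixes u :: "'r::{ring, monoid_mult}"
  shows "(1 - u) * (\<Sum>k<N. u ^ k) = 1 - u ^ N"
proof (induction N)
  case (Suc N)
  have "(1 - u) * (\<Sum>k<Suc N. u ^ k) = (1 - u) * (\<Sum>k<N. u ^ k) + (1 - u) * u ^ N"
    by (simp only: sum.lessThan_Suc distrib_left)
  also have "\<dots> = 1 - u ^ N + (u ^ N - u * u ^ N)"
    by (subst Suc.IH) (simp only: left_diff_distrib mult_1_left)
  finally show ?case by simp
qed simp

lemma uminus_power_eq_0:
  fixes u :: "'r::{ring, monoid_mult}"
  assumes "u ^ N = 0"
  shows "(- u) ^ N = 0"
proof -
  have "(- u) ^ n = u ^ n \<or> (- u) ^ n = - (u ^ n)" for n
    by (induction n) auto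
  from this[of N] show ?thesis using assms by auto
qed

lemma one_plus_mult_geometric_sum:
  fixes h :: "'r::{ring, monoid_mult}"
  assumes "h ^ N = 0"
  shows "(1 + h) * (\<Sum>k<N. (- h) ^ k) = 1"
  using one_minus_mult_geometric_sum[of "- h" N] uminus_power_eq_0[OF assms] by simp

text \<open>Exposes a power of \<open>a\<close> inside \<open>b\<close>, on which the third Drazin
  equation can act.\<close>

lemma drazin_inverse_power_left:
  fixes a b :: "'r::{ring, monoid_mult}"
  assumes "drazin_inverse a b"
  shows "b = b ^ Suc k * a ^ k"
proof (induction k)
  case (Suc k)
  have c: "b * a = a * b" "b * (a * b) = b" 
    using assms unfolding drazin_inverse_def by (auto simp: mult.assoc)
  have "b ^ Suc (Suc k) * a ^ Suc k = b ^ k * (b * (b * a)) * a ^ k"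
    by (simp only: power_Suc2[of b "Suc k"] power_Suc2[of b k] power_Suc[of a] mult.assoc)
  also have "\<dots> = b ^ k * b * a ^ k" by (simp only: c)
  also have "\<dots> = b ^ Suc k * a ^ k" by (simp only: power_Suc2)
  finally show ?case using Suc by simp
qed simp

text \<open>The idempotent \<open>p = a * b\<close> has \<open>a ^ k\<close> as a left factor and as
  a right factor. Since \<open>a ^ k\<close> absorbs \<open>p\<close> and commutes with
  \<open>n\<close>, the product \<open>p * n * p\<close> equals both \<open>p * n\<close> and
  \<open>n * p\<close>. From \<open>b = b * p = p * b\<close> the claim for \<open>b\<close>
  follows.\<close>

lemma drazin_inverse_commutes:
  fixes a b n :: "'r::{ring, monoid_mult}"
  assumes ab: "drazin_inverse a b" and an: "a * n = n * a"
  shows "b * n = n * b"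
proof -
  have c: "b * a = a * b" "b * a * b = b"
    using ab unfolding drazin_inverse_def by auto
  obtain k where k: "a ^ k * b * a = a ^ k"
    using ab unfolding drazin_inverse_def by auto
  define p where "p = a * b"
  have kp: "a ^ k * p = a ^ k" using k c by (simp add: p_def mult.assoc)
  have ank: "a ^ k * n = n * a ^ k" by (rule power_commuting_commutes[OF an])
  have b1: "b = b ^ Suc k * a ^ k" by (rule drazin_inverse_power_left[OF ab])
  have p1: "p = (a * b ^ Suc k) * a ^ k"
    unfolding p_def by (subst b1) (simp only: mult.assoc)
  have p2: "p = a ^ k * (b ^ Suc k * a)"
  proof -
    have "p = b * a" by (simp add: p_def c)
    also have "\<dots> = b ^ Suc k * a ^ k * a" using b1 by metis
    also have "b ^ Suc k * a ^ k = a ^ k * b ^ Suc k"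
      by (rule power_commuting_commutes) (rule power_commuting_commutes[OF c(1)[symmetric], symmetric])
    finally show ?thesis by (simp only: mult.assoc)
  qed
  have "a * p = p * a" using c(1) by (simp add: p_def mult.assoc)
  then have kp': "p * a ^ k = a ^ k" using kp power_commuting_commutes[of a p k] by simp
  have "p * n * p = a * b ^ Suc k * (a ^ k * n) * p" by (subst p1) (simp only: mult.assoc)
  also have "\<dots> = a * b ^ Suc k * (n * (a ^ k * p))" by (simp only: ank mult.assoc)
  also have "\<dots> = a * b ^ Suc k * (n * a ^ k)" by (simp only: kp)
  also have "\<dots> = p * n" by (subst p1) (simp only: ank[symmetric] mult.assoc)
  finally have 1: "p * n * p = p * n" .
  have "p * n * p = p * (n * a ^ k) * (b ^ Suc k * a)" by (subst (2) p2) (simp only: mult.assoc)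
  also have "\<dots> = (p * a ^ k) * n * (b ^ Suc k * a)" by (simp only: ank[symmetric] mult.assoc)
  also have "\<dots> = a ^ k * n * (b ^ Suc k * a)" by (simp only: kp')
  also have "\<dots> = n * p" by (subst p2) (simp only: ank mult.assoc)
  finally have 2: "p * n = n * p" using 1 by simp
  have bp: "b * p = b" "p * b = b" using c by (simp_all add: p_def mult.assoc[symmetric])
  have "b * n = b * (p * n)" using bp by (simp add: mult.assoc[symmetric])
  also have "\<dots> = b * (n * p)" by (simp only: 2)
  also have "\<dots> = b * (n * a) * b" by (simp only: p_def mult.assoc)
  also have "\<dots> = b * a * n * b" by (simp only: an[symmetric] mult.assoc)
  also have "\<dots> = p * n * b" by (simp only: p_def c(1))
  also have "\<dots> = n * (p * b)" by (simp only: 2 mult.assoc)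
  finally show ?thesis by (simp only: bp)
qed

text \<open>Both inverses equal \<open>b * a * c\<close>: a power of \<open>a\<close> drawn out of
  one of them absorbs the other. They commute because each commutes with all that commutes with
  \<open>a\<close>.\<close>

lemma drazin_inverse_unique:
  fixes a b c :: "'r::{ring, monoid_mult}"
  assumes ab: "drazin_inverse a b" and ac: "drazin_inverse a c"
  shows "b = c"
proof -
  have *: "b = b * a * c" if ab: "drazin_inverse a b" and ac: "drazin_inverse a c" for b c :: 'r
  proof -
    obtain k where k: "a ^ k * c * a = a ^ k" using ac unfolding drazin_inverse_def by auto
    have ca: "c * a = a * c" using ac unfolding drazin_inverse_def by auto
    have b1: "b = b ^ Suc k * a ^ k" by (rule drazin_inverse_power_left[OF ab])
    have "b * a * c = b ^ Suc k * (a ^ k * c * a)"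
      by (subst b1) (simp only: mult.assoc ca)
    then show ?thesis by (simp only: k b1[symmetric])
  qed
  have "a * b = b * a" using ab unfolding drazin_inverse_def by auto
  then have bc: "b * c = c * b"
    using drazin_inverse_commutes[OF ac] by simp
  have "b = b * a * c" by (rule *[OF ab ac])
  also have "\<dots> = a * (b * c)" using \<open>a * b = b * a\<close> by (simp add: mult.assoc[symmetric])
  also have "\<dots> = c * a * b" using ac by (simp add: drazin_inverse_def bc mult.assoc[symmetric])
  also have "\<dots> = c" by (rule *[OF ac ab, symmetric])
  finally show ?thesis .
qed

text \<open>The binomial expansion, one factor \<open>a + n\<close> at a time: the counters
  \<open>i\<close> and \<open>j\<close> collect the powers until \<open>i \<ge> k\<close> or
  \<open>j \<ge> N\<close>.\<close>

lemma commuting_binomial_eq_0: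
  fixes a n q :: "'r::{ring, monoid_mult}"
  assumes an: "a * n = n * a" and a: "q * a ^ k = 0" and n: "n ^ N = 0"
  shows "i + j + m \<ge> k + N \<Longrightarrow> q * a ^ i * n ^ j * (a + n) ^ m = 0"
proof (induction m arbitrary: i j)
  case 0
  then consider "i \<ge> k" | "j \<ge> N" by linarith
  then show ?case
  proof cases
    case 1
    then have "q * a ^ i = 0" using a power_add[of a k "i - k"] by (simp add: mult.assoc[symmetric])
    then show ?thesis by simp
  next
    case 2
    then have "n ^ j = 0" using n power_add[of n N "j - N"] by simp
    then show ?thesis by simp
  qed
next
  case (Suc m)
  have "n ^ j * a = a * n ^ j" by (rule power_commuting_commutes[OF an[symmetric]])
  then have "q * a ^ i * n ^ j * a = q * a ^ Suc i * n ^ j"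
    by (simp only: power_Suc2 mult.assoc)
  then have "q * a ^ i * n ^ j * (a + n) ^ Suc m =
      q * a ^ Suc i * n ^ j * (a + n) ^ m + q * a ^ i * n ^ Suc j * (a + n) ^ m"
    by (simp only: power_Suc[of "a + n"] power_Suc2[of n] mult.assoc[symmetric] distrib_left distrib_right)
  then show ?case using Suc.IH[of "Suc i" j] Suc.IH[of i "Suc j"] Suc.prems by simp
qed

text \<open>With \<open>p = a * b\<close> and the nilpotent \<open>h = b * n\<close> we have
  \<open>(a + n) * b = p * (1 + h)\<close>, so \<open>b\<close> times the inverse of
  \<open>1 + h\<close> inverts \<open>a + n\<close> on the corner of \<open>p\<close>. On the
  complement \<open>1 - p\<close> the element \<open>a\<close> is nilpotent, hence so is
  \<open>a + n\<close>.\<close>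

lemma drazin_inverse_add_nilpotent:
  fixes a b n :: "'r::{ring, monoid_mult}"
  assumes ab: "drazin_inverse a b" and an: "a * n = n * a" and N: "n ^ N = 0"
  shows "drazin_inverse (a + n) (b * (\<Sum>k<N. (- (b * n)) ^ k))"
proof -
  have c: "b * a = a * b" "b * a * b = b"
    using ab unfolding drazin_inverse_def by auto
  obtain k where k: "a ^ k * b * a = a ^ k"
    using ab unfolding drazin_inverse_def by auto
  have bn: "b * n = n * b" by (rule drazin_inverse_commutes[OF ab an])
  define p h where "p = a * b" and "h = b * n"
  define g where "g = (\<Sum>k<N. (- h) ^ k)"
  have hN: "h ^ N = 0" unfolding h_def by (simp add: power_mult_commuting[OF bn] N)
  have hg: "(1 + h) * g = 1" unfolding g_def by (rule one_plus_mult_geometric_sum[OF hN])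
  have g_comm: "z * g = g * z" if "z * h = h * z" for z
    unfolding g_def by (rule sum_power_commuting) (simp add: that)
  have comm: "a * h = h * a" "b * h = h * b" "n * h = h * n"
    unfolding h_def using c(1) bn an by (metis mult.assoc)+
  have "p * b = b" using c by (simp add: p_def)
  then have ph: "p * h = h" unfolding h_def by (simp add: mult.assoc[symmetric])
  have bp: "b * p = b" "p * b = b" "p * p = p"
    using c by (auto simp: p_def mult.assoc) (metis mult.assoc)+
  have "(a + n) * (b * g) = (p + h) * g"
    unfolding p_def h_def by (simp add: distrib_right bn mult.assoc)
  also have "\<dots> = p * ((1 + h) * g)" using ph by (simp add: algebra_simps mult.assoc[symmetric])
  finally have 1: "(a + n) * (b * g) = p" using hg by simp
  have "(a + n) * g = g * (a + n)" by (rule g_comm) (simp add: comm distrib_left distrib_right)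
  then have "(b * g) * (a + n) = b * (a + n) * g" by (simp add: mult.assoc)
  also have "b * (a + n) = (a + n) * b" by (simp add: algebra_simps c bn)
  finally have 2: "(b * g) * (a + n) = p" using 1 by (simp add: mult.assoc)
  have "p * h = h * p" unfolding p_def using comm by (metis mult.assoc)
  then have pg: "p * g = g * p" by (rule g_comm)
  have "b * g * p = b * p * g" by (simp add: pg mult.assoc)
  then have 3: "b * g * p = b * g" using bp by simp
  have qk: "(1 - p) * a ^ k = 0"
  proof -
    have "a * p = p * a" using c(1) by (simp add: p_def mult.assoc)
    then have "p * a ^ k = a ^ k * p" using power_commuting_commutes[of a p k] by simp
    also have "\<dots> = a ^ k" using k by (simp only: p_def c(1)[symmetric] mult.assoc)
    finally show ?thesis by (simp add: left_diff_distrib)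
  qed
  have "(1 - p) * (a + n) ^ (k + N) = 0"
    using commuting_binomial_eq_0[OF an qk N, of 0 0 "k + N"] by simp
  moreover have "(a + n) * p = p * (a + n)" using 1 2 mult.assoc[of "a + n" "b * g" "a + n"] by simp
  ultimately have "(a + n) ^ (k + N) * p = (a + n) ^ (k + N)"
    using power_commuting_commutes[of "a + n" p "k + N"] by (simp add: algebra_simps)
  then have 4: "(a + n) ^ (k + N) * (b * g) * (a + n) = (a + n) ^ (k + N)"
    using 2 by (simp add: mult.assoc)
  have 5: "b * g * (a + n) * (b * g) = b * g"
    by (simp only: mult.assoc[of "b * g" "a + n"] 1 3)
  show ?thesis
    unfolding drazin_inverse_def g_def[symmetric] h_def[symmetric]
    using 1 2 4 5 by auto
qed

section \<open>The Gelfand--Mazur theorem\<close>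

lemma scaleC_one: "1 *\<^sub>C x = (x :: 'a::complex_banach_algebra_1)"
  using scaleC_of_real[of 1 x] by simp

interpretation complex_vector: vector_space
  "scaleC :: complex \<Rightarrow> 'a \<Rightarrow> 'a::complex_banach_algebra_1"
  by unfold_locales (simp_all add: scaleC_add_right scaleC_add_left scaleC_scaleC scaleC_one)

lemmas scaleC_zero_left [simp] = complex_vector.scale_zero_left
  and scaleC_zero_right [simp] = complex_vector.scale_zero_right

lemma sum_roots_of_unity_power:
  fixes n k :: nat
  assumes "0 < k" "k < n"
  shows "(\<Sum>j<n. (cis (2 * pi * real j / real n)) ^ k) = 0"
proof -
  define w where "w = cis (2 * pi * real k / real n)"
  have "w \<noteq> 1"
  proof
    assume "w = 1"
    then have "cos (2 * pi * real k / real n) = 1" by (simp add: w_def complex_eq_iff)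
    then obtain m :: int where m: "2 * pi * real k / real n = real_of_int m * 2 * pi"
      using cos_one_2pi_int by auto
    then have "real k = real_of_int m * real n"
      using assms by (simp add: field_simps)
    then have "real_of_int (int k) = real_of_int (m * int n)" by simp
    then have "int k = m * int n" by (simp only: of_int_eq_iff)
    then have "int n dvd int k" by simp
    then show False using assms by (simp add: dvd_imp_le nat_dvd_not_less)
  qed
  have "w ^ n = 1"
    using assms cis_multiple_2pi[of "real k"] by (simp add: w_def Complex.DeMoivre)
  have "(\<Sum>j<n. (cis (2 * pi * real j / real n)) ^ k) = (\<Sum>j<n. w ^ j)"
    by (simp add: w_def Complex.DeMoivre mult_ac)
  also have "\<dots> = 0" using \<open>w \<noteq> 1\<close> \<open>w ^ n = 1\<close> by (simp add: geometric_sum)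
  finally show ?thesis .
qed

text \<open>Iterating the resolvent identity expands \<open>R (z + d)\<close> in powers of
  \<open>d\<close> with an exact remainder. For \<open>d = h * \<omega> j\<close> the sum over
  \<open>j\<close> kills all powers but the constant one, and the remainders share the factor
  \<open>h ^ n\<close> because \<open>\<omega> j ^ n = 1\<close>.\<close>

lemma pseudo_resolvent_mean:
  fixes R :: "complex \<Rightarrow> 'a::complex_banach_algebra_1"
  assumes res: "\<And>z w. R z - R w = (z - w) *\<^sub>C (R z * R w)" and n: "n > 0"
  defines "\<omega> j \<equiv> cis (2 * pi * real j / real n)"
  shows "(\<Sum>j<n. R (z + h * \<omega> j)) - h ^ n *\<^sub>C (\<Sum>j<n. R (z + h * \<omega> j)) * R z ^ n = of_nat n * R z"
proof -
  have step: "R (z + d) - d ^ m *\<^sub>C R (z + d) * R z ^ m = (\<Sum>k<m. d ^ k *\<^sub>C R z ^ Suc k)" for d m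
  proof (induction m)
    case (Suc m)
    have "R (z + d) = R z + d *\<^sub>C (R (z + d) * R z)"
      using res[of "z + d" z] by (simp add: algebra_simps)
    then have "d ^ m *\<^sub>C R (z + d) * R z ^ m =
       d ^ m *\<^sub>C (R z + d *\<^sub>C (R (z + d) * R z)) * R z ^ m" by simp
    also have "\<dots> = d ^ m *\<^sub>C R z ^ Suc m + d ^ Suc m *\<^sub>C R (z + d) * R z ^ Suc m"
      by (simp add: scaleC_add_right mult_scaleC_left scaleC_scaleC distrib_right mult.assoc mult.commute)
    finally show ?case
      unfolding sum.lessThan_Suc Suc.IH[symmetric] by simp
  qed simp
  have \<omega>n: "\<omega> j ^ n = 1" for j
    unfolding \<omega>_def using n cis_multiple_2pi[of "real j"] by (simp add: Complex.DeMoivre)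
  have "(\<Sum>j<n. R (z + h * \<omega> j)) - h ^ n *\<^sub>C (\<Sum>j<n. R (z + h * \<omega> j)) * R z ^ n =
      (\<Sum>j<n. R (z + h * \<omega> j) - (h * \<omega> j) ^ n *\<^sub>C R (z + h * \<omega> j) * R z ^ n)"
    by (simp add: sum_subtractf power_mult_distrib \<omega>n complex_vector.scale_sum_right sum_distrib_right)
  also have "\<dots> = (\<Sum>j<n. \<Sum>k<n. (h ^ k * \<omega> j ^ k) *\<^sub>C R z ^ Suc k)"
    unfolding step by (simp only: power_mult_distrib)
  also have "\<dots> = (\<Sum>k<n. \<Sum>j<n. (h ^ k * \<omega> j ^ k) *\<^sub>C R z ^ Suc k)"
    by (rule sum.swap)
  also have "\<dots> = (\<Sum>k<n. (h ^ k * (\<Sum>j<n. \<omega> j ^ k)) *\<^sub>C R z ^ Suc k)"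
    by (simp only: sum_distrib_left complex_vector.scale_sum_left)
  also have "\<dots> = (\<Sum>k\<in>{0}. (h ^ k * (\<Sum>j<n. \<omega> j ^ k)) *\<^sub>C R z ^ Suc k)"
    by (rule sum.mono_neutral_right) (use n in \<open>auto simp: \<omega>_def sum_roots_of_unity_power\<close>)
  also have "\<dots> = of_nat n * R z"
    using scaleC_of_real[of "real n" "R z"] by (simp add: scaleR_conv_of_real)
  finally show ?thesis .
qed

text \<open>By the preceding identity, \<open>R z\<close> is up to an error of order \<open>(h M)^n\<close> the mean of \<open>R\<close> over
  \<open>n\<close> equidistant points on a circle around \<open>z\<close>. If \<open>norm (R z) = M\<close> is maximal, all these values
  must therefore have norm \<open>M\<close>, so the maximum propagates to infinity. This replaces Liouville's
  theorem, which the library only has for complex-valued functions.\<close>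

lemma pseudo_resolvent_max_propagates:
  fixes R :: "complex \<Rightarrow> 'a::complex_banach_algebra_1"
  assumes res: "\<And>z w. R z - R w = (z - w) *\<^sub>C (R z * R w)"
    and M: "\<And>w. norm (R w) \<le> M" and z: "norm (R z) = M" and h: "cmod h * M < 1"
  shows "norm (R (z + h)) = M"
proof -
  define q where "q = cmod h * M"
  have M0: "M \<ge> 0" using norm_ge_zero[of "R z"] z by linarith
  have q: "0 \<le> q" "q < 1" using h M0 by (simp_all add: q_def)
  have bound: "M - norm (R (z + h)) \<le> M * (real n * q ^ n)" if n: "n > 0" for n :: nat
  proof -
    define \<omega> where "\<omega> j = cis (2 * pi * real j / real n)" for j
    define S where "S = (\<Sum>j<n. R (z + h * \<omega> j))"
    have "S - h ^ n *\<^sub>C S * R z ^ n = of_nat n * R z"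
      unfolding S_def \<omega>_def by (rule pseudo_resolvent_mean[OF res n])
    then have "of_nat n * R z = S - h ^ n *\<^sub>C S * R z ^ n" by simp
    then have "norm (of_nat n * R z) \<le> norm S + norm (h ^ n *\<^sub>C S * R z ^ n)"
      using norm_triangle_ineq4 by metis
    moreover have "norm (of_nat n * R z) = real n * M"
      using z by (metis norm_scaleR of_nat_0_le_iff abs_of_nonneg scaleR_conv_of_real of_real_of_nat_eq)
    moreover have "norm (h ^ n *\<^sub>C S * R z ^ n) \<le> M * (real n * q ^ n)"
    proof -
      have "norm S \<le> (\<Sum>j<n. norm (R (z + h * \<omega> j)))" unfolding S_def by (rule norm_sum)
      also have "\<dots> \<le> real n * M" using sum_mono[of "{..<n}" "\<lambda>j. norm (R (z + h * \<omega> j))" "\<lambda>_. M"] M by simp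
      finally have S: "norm S \<le> real n * M" .
      have "norm (h ^ n *\<^sub>C S * R z ^ n) \<le> norm (h ^ n *\<^sub>C S) * norm (R z ^ n)"
        by (rule norm_mult_ineq)
      also have "\<dots> \<le> (cmod h ^ n * norm S) * M ^ n"
        using norm_power_ineq[of "R z" n] z by (auto simp: norm_scaleC norm_power intro!: mult_left_mono)
      also have "\<dots> \<le> (cmod h ^ n * (real n * M)) * M ^ n"
        using S M0 by (intro mult_right_mono mult_left_mono) auto
      also have "\<dots> = M * (real n * q ^ n)" by (simp add: q_def power_mult_distrib)
      finally show ?thesis .
    qed
    \<comment> \<open>The term \<open>j = 0\<close> belongs to \<open>z + h\<close> itself. The
      other \<open>n - 1\<close> are at most \<open>M\<close>, so they cannot make up for a deficit
      at \<open>z + h\<close>.\<close>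
    moreover have "norm S \<le> norm (R (z + h)) + real (n - 1) * M"
    proof -
      have "norm S \<le> (\<Sum>j<n. norm (R (z + h * \<omega> j)))" unfolding S_def by (rule norm_sum)
      also have "\<dots> = norm (R (z + h * \<omega> 0)) + (\<Sum>j\<in>{..<n} - {0}. norm (R (z + h * \<omega> j)))"
        using n by (intro sum.remove) auto
      also have "(\<Sum>j\<in>{..<n} - {0}. norm (R (z + h * \<omega> j))) \<le> (\<Sum>j\<in>{..<n} - {0}. M)"
        by (intro sum_mono M)
      also have "(\<Sum>j\<in>{..<n} - {0}. M) = real (n - 1) * M" using n by simp
      finally show ?thesis by (simp add: \<omega>_def)
    qed
    moreover have "real n * M = M + real (n - 1) * M" using n by (simp add: algebra_simps of_nat_diff)
    ultimately show ?thesis by linarith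
  qed
  have "(\<lambda>n. M * (real n * q ^ n)) \<longlonglongrightarrow> M * 0"
    by (intro tendsto_mult_left powser_times_n_limit_0) (use q in auto)
  then have "M - norm (R (z + h)) \<le> M * 0"
    by (rule tendsto_lowerbound) (auto intro!: eventually_sequentiallyI[of 1] bound)
  then show ?thesis using M[of "z + h"] by simp
qed

lemma pseudo_resolvent_norm_continuous:
  fixes R :: "complex \<Rightarrow> 'a::complex_banach_algebra_1"
  assumes res: "\<And>z w. R z - R w = (z - w) *\<^sub>C (R z * R w)"
  shows "isCont (\<lambda>w. norm (R w)) z"
proof -
  \<comment> \<open>With this radius \<open>norm (R z) * r \<le> 1 / 2\<close>, so half of the
    unknown \<open>norm (R w)\<close> is absorbed in the triangle inequality; the \<open>+ 1\<close>
    covers \<open>R z = 0\<close>.\<close>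
  define r where "r = 1 / (2 * (norm (R z) + 1))"
  have r: "r > 0" unfolding r_def by (simp add: add_nonneg_pos)
  have bd: "norm (R w) \<le> 2 * norm (R z)" if "dist w z < r" for w
  proof -
    have "norm (R w - R z) \<le> cmod (w - z) * (norm (R w) * norm (R z))"
      unfolding res[of w z] norm_scaleC by (intro mult_left_mono norm_mult_ineq) auto
    also have "\<dots> \<le> r * (norm (R w) * norm (R z))"
      using that by (intro mult_right_mono) (auto simp: dist_norm)
    also have "\<dots> = norm (R w) * (norm (R z) * r)" by simp
    also have "\<dots> \<le> norm (R w) * (1 / 2)"
    proof (intro mult_left_mono norm_ge_zero)
      have half: "N * (1 / (2 * (N + 1))) \<le> 1 / 2" if "N \<ge> 0" for N :: real
        using that by (simp add: field_simps)
      show "norm (R z) * r \<le> 1 / 2" unfolding r_def by (rule half) simp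
    qed
    finally show ?thesis using norm_triangle_ineq2[of "R w" "R z"] by linarith
  qed
  have "((\<lambda>w. cmod (w - z) * (2 * norm (R z) * norm (R z))) \<longlongrightarrow> cmod (z - z) * (2 * norm (R z) * norm (R z))) (at z)"
    by (intro tendsto_intros)
  then have "((\<lambda>w. cmod (w - z) * (2 * norm (R z) * norm (R z))) \<longlongrightarrow> 0) (at z)" by simp
  moreover have "\<forall>\<^sub>F w in at z. norm (R w - R z) \<le> cmod (w - z) * (2 * norm (R z) * norm (R z))"
    unfolding eventually_at
  proof (intro exI[of _ r] conjI ballI impI r)
    fix w assume w: "w \<noteq> z \<and> dist w z < r"
    have "norm (R w - R z) \<le> cmod (w - z) * (norm (R w) * norm (R z))"
      unfolding res[of w z] norm_scaleC by (intro mult_left_mono norm_mult_ineq) auto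
    also have "\<dots> \<le> cmod (w - z) * (2 * norm (R z) * norm (R z))"
      using bd w by (intro mult_left_mono mult_right_mono) auto
    finally show "norm (R w - R z) \<le> cmod (w - z) * (2 * norm (R z) * norm (R z))" .
  qed
  ultimately have "((\<lambda>w. R w - R z) \<longlongrightarrow> 0) (at z)"
    by (rule Lim_null_comparison[rotated])
  then have "(R \<longlongrightarrow> R z) (at z)" using LIM_zero_iff by blast
  then show ?thesis unfolding isCont_def by (rule tendsto_norm)
qed

text \<open>Decay and compactness yield a point of maximal norm \<open>M > 0\<close>. Steps of fixed
  length \<open>1 / (2 * M)\<close> then carry the value \<open>M\<close> out to infinity, against
  the decay.\<close>

lemma pseudo_resolvent_eq_0:
  fixes R :: "complex \<Rightarrow> 'a::complex_banach_algebra_1"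
  assumes res: "\<And>z w. R z - R w = (z - w) *\<^sub>C (R z * R w)"
    and decay: "(R \<longlongrightarrow> 0) at_infinity"
  shows "R z = 0"
proof (rule ccontr)
  assume nz: "R z \<noteq> 0"
  have "\<forall>\<^sub>F w in at_infinity. norm (R w) < norm (R z)"
    using tendstoD[OF decay, of "norm (R z)"] nz by simp
  then obtain b where b: "\<And>w. b \<le> cmod w \<Longrightarrow> norm (R w) < norm (R z)"
    unfolding eventually_at_infinity by blast
  have zb: "z \<in> cball 0 b" using b[of z] by (metis dist_0_norm less_irrefl linear mem_cball)
  have "continuous_on (cball 0 b) (\<lambda>w. norm (R w))"
    by (rule continuous_at_imp_continuous_on) (simp add: pseudo_resolvent_norm_continuous[OF res])
  then obtain z0 where z0: "z0 \<in> cball 0 b" "\<And>w. w \<in> cball 0 b \<Longrightarrow> norm (R w) \<le> norm (R z0)"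
    using continuous_attains_sup[OF compact_cball] zb by (metis empty_iff)
  define M where "M = norm (R z0)"
  have zM: "norm (R z) \<le> M" unfolding M_def by (rule z0(2)[OF zb])
  have M: "norm (R w) \<le> M" for w
    using z0(2)[of w] b[of w] zM unfolding M_def by (cases "cmod w \<le> b") auto
  have M0: "M > 0" using zM nz by (meson less_le_trans zero_less_norm_iff)
  define h where "h = complex_of_real (1 / (2 * M))"
  have h: "cmod h * M < 1" "cmod h > 0" using M0 by (simp_all add: h_def norm_divide norm_mult)
  have walk: "norm (R (z0 + of_nat n * h)) = M" for n :: nat
  proof (induction n)
    case (Suc n)
    have "norm (R ((z0 + of_nat n * h) + h)) = M"
      by (rule pseudo_resolvent_max_propagates[OF res M Suc h(1)])
    then show ?case by (simp add: algebra_simps)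
  qed (simp add: M_def)
  obtain n :: nat where n: "real n * cmod h > b + cmod z0"
    using reals_Archimedean3[OF h(2)] by blast
  have "b \<le> cmod (z0 + of_nat n * h)"
    using n norm_triangle_ineq2[of "of_nat n * h" "- z0"] by (simp add: norm_mult add.commute)
  then show False using b walk[of n] zM by force
qed

section \<open>Primitive algebras are prime\<close>

definition prime_ring :: "'a::ring_1 itself \<Rightarrow> bool" where
  "prime_ring _ \<longleftrightarrow> (\<forall>a b::'a. (\<forall>c. a * c * b = 0) \<longrightarrow> a = 0 \<or> b = 0)"

text \<open>The vectors \<open>w\<close> with \<open>\<rho> a (\<rho> c w) = 0\<close> for all
  \<open>c\<close> form an invariant subspace that contains the image of \<open>\<rho> b\<close>. If
  it is \<open>{0}\<close>, faithfulness gives \<open>b = 0\<close>; if it is \<open>V\<close>, it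
  gives \<open>a = 0\<close>.\<close>

lemma primitive_imp_prime:
  assumes "primitive_algebra TYPE('a::complex_banach_algebra_1) TYPE('v::ab_group_add)"
  shows "prime_ring TYPE('a)"
  unfolding prime_ring_def
proof (intro allI impI)
  fix a b :: 'a assume ab: "\<forall>c. a * c * b = 0"
  obtain s :: "complex \<Rightarrow> 'v \<Rightarrow> 'v" and V \<rho> where
    rep: "representation s V (\<rho> :: 'a \<Rightarrow> 'v \<Rightarrow> 'v)" and faith: "faithful_on V \<rho>"
    and irr: "irreducible_on s V \<rho>"
    using assms unfolding primitive_algebra_def by blast
  interpret vs: vector_space s using rep unfolding representation_def by blast
  have V: "vs.subspace V"
    and inV: "\<And>a v. v \<in> V \<Longrightarrow> \<rho> a v \<in> V"
    and addv: "\<And>a v w. v \<in> V \<Longrightarrow> w \<in> V \<Longrightarrow> \<rho> a (v + w) = \<rho> a v + \<rho> a w"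
    and scalev: "\<And>a c v. v \<in> V \<Longrightarrow> \<rho> a (s c v) = s c (\<rho> a v)"
    and scalea: "\<And>a c v. v \<in> V \<Longrightarrow> \<rho> (c *\<^sub>C a) v = s c (\<rho> a v)"
    and multa: "\<And>a b v. v \<in> V \<Longrightarrow> \<rho> (a * b) v = \<rho> a (\<rho> b v)"
    using rep unfolding representation_def by blast+
  have V0: "0 \<in> V" by (rule vs.subspace_0[OF V])
  have \<rho>0: "\<rho> 0 v = 0" if "v \<in> V" for v
    using scalea[OF that, of 0 0] by simp
  have \<rho>v0: "\<rho> c 0 = 0" for c
    using scalev[OF V0, of c 0] by simp
  define K where "K = {w \<in> V. \<forall>c. \<rho> a (\<rho> c w) = 0}"
  have "vs.subspace K"
    by (rule vs.subspaceI)
       (auto simp: K_def V0 \<rho>v0 addv scalev inV vs.subspace_add[OF V] vs.subspace_scale[OF V])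
  moreover have "K \<subseteq> V" unfolding K_def by auto
  moreover have "\<forall>d. \<forall>w\<in>K. \<rho> d w \<in> K"
    by (auto simp: K_def inV multa[symmetric])
  ultimately have K: "K = {0} \<or> K = V" using irr unfolding irreducible_on_def by blast
  have bK: "\<rho> b v \<in> K" if "v \<in> V" for v
    unfolding K_def using that ab by (auto simp: inV multa[symmetric] \<rho>0 mult.assoc[symmetric])
  show "a = 0 \<or> b = 0"
  proof (cases "K = {0}")
    case True
    then have "\<forall>v\<in>V. \<rho> b v = \<rho> 0 v" using bK \<rho>0 by auto
    then show ?thesis using faith unfolding faithful_on_def by blast
  next
    case False
    \<comment> \<open>A \<open>representation\<close> need not send \<open>1\<close> to the identity
      of \<open>V\<close>, so the case \<open>c = 1\<close> speaks about \<open>a * 1\<close>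
      first.\<close>
    then have "\<rho> (a * 1) v = \<rho> 0 v" if "v \<in> V" for v
      using K that by (metis (mono_tags, lifting) K_def \<rho>0 mem_Collect_eq multa)
    then have "a * 1 = 0" using faith unfolding faithful_on_def by blast
    then show ?thesis by simp
  qed
qed

section \<open>Minimal right ideals and minimal idempotents\<close>

lemma right_ideal_translate:
  assumes "right_ideal J"
  shows "right_ideal ((\<lambda>y. x * y) ` J)"
  unfolding right_ideal_def
proof (intro conjI ballI allI)
  show "0 \<in> (\<lambda>y. x * y) ` J"
    using assms unfolding right_ideal_def by (auto intro!: image_eqI[of _ _ 0])
next
  fix u v assume "u \<in> (\<lambda>y. x * y) ` J" "v \<in> (\<lambda>y. x * y) ` J"
  then show "u + v \<in> (\<lambda>y. x * y) ` J"
    using assms unfolding right_ideal_def by (auto simp: distrib_left[symmetric])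
next
  fix u a assume "u \<in> (\<lambda>y. x * y) ` J"
  then show "u * a \<in> (\<lambda>y. x * y) ` J"
    using assms unfolding right_ideal_def by (auto simp: mult.assoc)
qed

lemma right_ideal_UNIV: "right_ideal UNIV"
  unfolding right_ideal_def by auto

lemma right_ideal_range: "right_ideal (range (\<lambda>y. x * y))"
  by (rule right_ideal_translate[OF right_ideal_UNIV])

lemma right_ideal_annihilator:
  assumes "right_ideal J"
  shows "right_ideal {y \<in> J. x * y = 0}"
  using assms unfolding right_ideal_def by (auto simp: distrib_left mult.assoc[symmetric])

lemma right_ideal_diff: "right_ideal J \<Longrightarrow> x \<in> J \<Longrightarrow> y \<in> J \<Longrightarrow> x - y \<in> J"
  unfolding right_ideal_def by (metis diff_conv_add_uminus mult_minus1_right)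

lemma minimal_right_ideal_eq_range:
  assumes "minimal_right_ideal J" "x \<in> J" "x \<noteq> 0"
  shows "J = range (\<lambda>y. x * y)"
proof -
  have "range (\<lambda>y. x * y) \<subseteq> J" using assms(1,2)
    unfolding minimal_right_ideal_def right_ideal_def by auto
  moreover have "x * 1 \<in> range (\<lambda>y. x * y)" by (rule rangeI)
  then have "range (\<lambda>y. x * y) \<noteq> {0}" using assms(3) by (metis mult_1_right singletonD)
  ultimately show ?thesis
    using assms(1) right_ideal_range[of x] unfolding minimal_right_ideal_def by metis
qed

text \<open>Brauer's lemma. Primeness gives \<open>x \<in> J\<close> with
  \<open>x * y \<noteq> 0\<close> for some \<open>y \<in> J\<close>. By minimality, left
  multiplication by \<open>x\<close> is then a bijection of \<open>J\<close>, and the preimage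
  \<open>e\<close> of \<open>x\<close> satisfies \<open>x * (e * e - e) = 0\<close>.\<close>

lemma minimal_right_ideal_idempotent:
  assumes prime: "prime_ring TYPE('a::ring_1)" and J: "minimal_right_ideal (J :: 'a set)"
  obtains e where "e \<in> J" "e \<noteq> 0" "e * e = e"
proof -
  have ri: "right_ideal J" and J0: "J \<noteq> {0}" using J unfolding minimal_right_ideal_def by auto
  have zJ: "0 \<in> J" using ri unfolding right_ideal_def by auto
  obtain y where y: "y \<in> J" "y \<noteq> 0" using J0 zJ by auto
  obtain c where c: "y * c * y \<noteq> 0" using prime y(2) unfolding prime_ring_def by blast
  define x where "x = y * c"
  have x: "x \<in> J" using ri y(1) unfolding x_def right_ideal_def by auto
  have xy: "x * y \<noteq> 0" using c by (simp add: x_def)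
  have "(\<lambda>y. x * y) ` J \<subseteq> J" using ri x unfolding right_ideal_def by auto
  moreover have "(\<lambda>y. x * y) ` J \<noteq> {0}" using xy y(1) by blast
  ultimately have "(\<lambda>y. x * y) ` J = J"
    using right_ideal_translate[OF ri, of x] J unfolding minimal_right_ideal_def by blast
  then obtain e where e: "e \<in> J" "x * e = x" using x by (metis imageE)
  have "{z \<in> J. x * z = 0} \<noteq> J" using xy y(1) by blast
  then have ann: "{z \<in> J. x * z = 0} = {0}"
    using right_ideal_annihilator[OF ri, of x] J unfolding minimal_right_ideal_def by blast
  have "e * e - e \<in> {z \<in> J. x * z = 0}"
    using e ri right_ideal_diff[OF ri, of "e * e" e]
    by (auto simp: right_diff_distrib mult.assoc[symmetric] right_ideal_def)
  then have "e * e = e" unfolding ann by simp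
  moreover have "e \<noteq> 0" using e xy by auto
  ultimately show thesis using e(1) that by blast
qed

text \<open>The corner \<open>e A e\<close> is a division algebra with unit \<open>e\<close>, since
  each of its nonzero elements generates \<open>J\<close>. If \<open>e * z * e\<close> were no
  multiple of \<open>e\<close>, all \<open>e * (z - c) * e\<close> would be invertible there, and
  the inverses would form a pseudo-resolvent that vanishes at infinity, hence everywhere.\<close>

lemma minimal_idempotent_corner:
  fixes e z :: "'a::complex_banach_algebra_1"
  assumes J: "minimal_right_ideal J" and e: "e \<in> J" "e \<noteq> 0" "e * e = e"
  shows "\<exists>c. e * z * e = c *\<^sub>C e"
proof (rule ccontr)
  assume neg: "\<nexists>c. e * z * e = c *\<^sub>C e"
  have rinv: "\<exists>w. (e * y * e) * (e * w * e) = e" if "e * y * e \<noteq> 0" for y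
  proof -
    have "e * y * e \<in> J" using J e(1) unfolding minimal_right_ideal_def right_ideal_def by (simp add: mult.assoc)
    then have "J = range (\<lambda>w. (e * y * e) * w)"
      by (rule minimal_right_ideal_eq_range[OF J]) (rule that)
    then obtain w where "e = (e * y * e) * w" using e(1) by blast
    then have "(e * y * e) * (e * w * e) = e"
      by (metis e(3) mult.assoc)
    then show ?thesis by blast
  qed
  define d where "d c = e * (z - c *\<^sub>C 1) * e" for c
  have d: "d c = e * z * e - c *\<^sub>C e" for c
    by (simp add: d_def right_diff_distrib left_diff_distrib mult_scaleC_left mult_scaleC_right e(3))
  have "\<exists>r. r = e * r * e \<and> d c * r = e" for c
  proof -
    have "d c \<noteq> 0" using neg by (simp add: d)
    then obtain w where "d c * (e * w * e) = e"
      using rinv[of "z - c *\<^sub>C 1"] unfolding d_def by blast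
    moreover have "e * (e * w * e) * e = e * w * e" by (metis e(3) mult.assoc)
    ultimately show ?thesis by metis
  qed
  then obtain R where R: "\<And>c. R c = e * R c * e" "\<And>c. d c * R c = e" by metis
  have eR: "e * R c = R c" "R c * e = R c" for c by (metis R(1) e(3) mult.assoc)+
  \<comment> \<open>The right inverse \<open>R c\<close> has a right inverse in turn, which must be
    \<open>d c\<close>.\<close>
  have Rd: "R c * d c = e" for c
  proof -
    have "R c \<noteq> 0" using R(2)[of c] e(2) by auto
    then obtain w where w: "R c * (e * w * e) = e" using rinv[of "R c"] R(1) by metis
    have "e * w * e = (d c * R c) * (e * w * e)" using R(2) by (metis e(3) mult.assoc)
    also have "\<dots> = d c * e" using w by (simp add: mult.assoc)
    also have "\<dots> = d c" by (simp add: d_def mult.assoc e(3))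
    finally show ?thesis using w by simp
  qed
  have res: "R u - R v = (u - v) *\<^sub>C (R u * R v)" for u v
  proof -
    have "d v - d u = (u - v) *\<^sub>C e" by (simp add: d complex_vector.scale_left_diff_distrib)
    then have "R u * (d v - d u) * R v = (u - v) *\<^sub>C (R u * R v)"
      by (simp add: mult_scaleC_left mult_scaleC_right eR)
    moreover have "R u * (d v - d u) * R v = R u * (d v * R v) - R u * d u * R v"
      by (simp add: right_diff_distrib left_diff_distrib mult.assoc)
    ultimately show ?thesis by (simp only: R(2) Rd eR)
  qed
  have bound: "norm (R c) \<le> norm e / (cmod c - norm (e * z * e))" if "cmod c > norm (e * z * e)" for c
  proof -
    have "c *\<^sub>C R c = (e * z * e) * R c - e"
      using R(2)[of c] by (simp add: d left_diff_distrib mult_scaleC_left eR algebra_simps)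
    then have "cmod c * norm (R c) \<le> norm (e * z * e * R c) + norm e"
      using norm_triangle_ineq4[of "e * z * e * R c" e] by (metis norm_scaleC)
    also have "\<dots> \<le> norm (e * z * e) * norm (R c) + norm e"
      by (intro add_right_mono norm_mult_ineq)
    finally have "norm (R c) * (cmod c - norm (e * z * e)) \<le> norm e" by (simp add: algebra_simps)
    then show ?thesis using that by (simp add: field_simps)
  qed
  have "((\<lambda>c. norm e / (cmod c - norm (e * z * e))) \<longlongrightarrow> 0) at_infinity"
  proof (rule tendsto_divide_0[OF tendsto_const])
    have "filterlim (\<lambda>c. - norm (e * z * e) + cmod c) at_top at_infinity"
      by (rule filterlim_tendsto_add_at_top[OF tendsto_const filterlim_norm_at_top])
    then show "filterlim (\<lambda>c. cmod c - norm (e * z * e)) at_infinity at_infinity"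
      by (intro filterlim_at_top_imp_at_infinity) simp
  qed
  moreover have "\<forall>\<^sub>F c in at_infinity. norm (R c) \<le> norm e / (cmod c - norm (e * z * e))"
    unfolding eventually_at_infinity by (rule exI[of _ "norm (e * z * e) + 1"]) (auto intro: bound)
  ultimately have "(R \<longlongrightarrow> 0) at_infinity" by (rule Lim_null_comparison[rotated])
  then have "R 0 = 0" by (rule pseudo_resolvent_eq_0[OF res])
  then show False using R(2)[of 0] e(2) by simp
qed

section \<open>The trace on the socle of a prime algebra\<close>

text \<open>\<open>u * e * v\<close> plays the role of an operator of rank at most one, and
  \<open>\<phi> (v * u)\<close> that of its trace.\<close>

locale rank_one_idempotent =
  fixes e :: "'a::complex_banach_algebra_1" and \<phi> :: "'a \<Rightarrow> complex"
  assumes prime: "prime_ring TYPE('a)"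
    and idem: "e * e = e"
    and nonzero: "e \<noteq> 0"
    and corner: "e * z * e = \<phi> z *\<^sub>C e"
begin

lemma phi_eqI: "e * z * e = c *\<^sub>C e \<Longrightarrow> \<phi> z = c"
  using corner[of z] nonzero by (simp add: complex_vector.scale_right_imp_eq)

lemma phi_add: "\<phi> (x + y) = \<phi> x + \<phi> y"
  by (rule phi_eqI) (simp add: distrib_left distrib_right corner scaleC_add_left)

lemma phi_scale: "\<phi> (c *\<^sub>C x) = c * \<phi> x"
  by (rule phi_eqI) (simp add: mult_scaleC_left mult_scaleC_right corner scaleC_scaleC)

lemma phi_zero [simp]: "\<phi> 0 = 0"
  by (rule phi_eqI) simp

lemma phi_diff: "\<phi> (x - y) = \<phi> x - \<phi> y"
  using phi_add[of "x - y" y] by simp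

lemma phi_mult: "\<phi> (u * e * v) = \<phi> u * \<phi> v"
proof (rule phi_eqI)
  have "e * (u * e * v) * e = (e * u * e) * v * e" by (simp add: mult.assoc)
  also have "\<dots> = \<phi> u *\<^sub>C (e * v * e)" unfolding corner by (simp add: mult_scaleC_left corner)
  finally show "e * (u * e * v) * e = (\<phi> u * \<phi> v) *\<^sub>C e" by (simp add: corner scaleC_scaleC)
qed

lemma primeD:
  fixes a b :: 'a
  assumes "\<And>c. a * c * b = 0"
  shows "a = 0 \<or> b = 0"
  using prime assms unfolding prime_ring_def by blast

text \<open>A nonzero \<open>k\<close> in \<open>e A\<close> satisfies \<open>k = e * k\<close>, so
  a nonzero \<open>k * c * e\<close> lies in the corner and is a nonzero multiple of
  \<open>e\<close>.\<close>

lemma minimal_right_ideal_e: "minimal_right_ideal (range (\<lambda>y. e * y))"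
  unfolding minimal_right_ideal_def
proof (intro conjI allI impI)
  show "right_ideal (range (\<lambda>y. e * y))" by (rule right_ideal_range)
  have "e * 1 \<in> range (\<lambda>y. e * y)" by (rule rangeI)
  then show "range (\<lambda>y. e * y) \<noteq> {0}" using nonzero by (metis mult_1_right singletonD)
  fix K assume K: "right_ideal K \<and> K \<subseteq> range (\<lambda>y. e * y)"
  show "K = {0} \<or> K = range (\<lambda>y. e * y)"
  proof (cases "K = {0}")
    case False
    have K0: "0 \<in> K" and Km: "\<And>x a. x \<in> K \<Longrightarrow> x * a \<in> K" using K unfolding right_ideal_def by auto
    obtain k where k: "k \<in> K" "k \<noteq> 0" using False K0 by auto
    have ek: "e * k = k" using K k(1) idem by (metis (no_types, lifting) imageE mult.assoc subsetD)
    obtain c where c: "k * c * e \<noteq> 0" using primeD[of k e] k(2) nonzero by blast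
    have kc: "k * c * e = \<phi> (k * c) *\<^sub>C e"
      using corner[of "k * c"] ek by (simp add: mult.assoc[symmetric])
    then have "\<phi> (k * c) \<noteq> 0" using c by auto
    then have "k * (c * e * (1 / \<phi> (k * c)) *\<^sub>C 1) = e"
      using kc by (simp add: mult.assoc[symmetric] mult_scaleC_right scaleC_scaleC scaleC_one)
    then have "e \<in> K" using Km[OF k(1)] by metis
    then have "range (\<lambda>y. e * y) \<subseteq> K" using Km by auto
    then show ?thesis using K by auto
  qed simp
qed

lemma minimal_right_ideal_translate_e:
  assumes "a * e \<noteq> 0"
  shows "minimal_right_ideal (range (\<lambda>y. a * e * y))"
proof -
  have eq: "(\<lambda>x. a * x) ` range (\<lambda>y. e * y) = range (\<lambda>y. a * e * y)"
    by (auto simp: mult.assoc)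
  have "a * e * 1 \<in> range (\<lambda>y. a * e * y)" by (rule rangeI)
  then have "range (\<lambda>y. a * e * y) \<noteq> {0}" using assms by (metis mult_1_right singletonD)
  then show ?thesis
    using minimal_right_ideal_left_translate[OF minimal_right_ideal_e, of a] unfolding eq by blast
qed

text \<open>Here primeness ties every minimal right ideal to the fixed \<open>e\<close>: a nonzero
  \<open>x * c * e\<close> lies in \<open>J\<close> and generates it.\<close>

lemma minimal_right_ideal_element:
  assumes J: "minimal_right_ideal J" and x: "x \<in> J"
  shows "\<exists>u v. x = u * e * v"
proof (cases "x = 0")
  case True
  then show ?thesis by (intro exI[of _ 0]) simp
next
  case False
  obtain c where c: "x * c * e \<noteq> 0" using primeD[of x e] False nonzero by blast
  have "x * c * e \<in> J" using J x unfolding minimal_right_ideal_def right_ideal_def by (simp add: mult.assoc)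
  then have "J = range (\<lambda>y. x * c * e * y)" by (rule minimal_right_ideal_eq_range[OF J _ c])
  then show ?thesis using x by auto
qed

lemma e_in_soc: "e \<in> soc"
proof -
  have "e * 1 \<in> range (\<lambda>y. e * y)" by (rule rangeI)
  then show ?thesis unfolding soc_def
    by (intro in_ideal_sum[of "range (\<lambda>y. e * y)"]) (simp_all add: minimal_right_ideal_e)
qed

lemma soc_sum: "(\<And>i. i \<in> I \<Longrightarrow> f i \<in> soc) \<Longrightarrow> (\<Sum>i\<in>I. f i) \<in> (soc :: 'a set)"
  by (induction I rule: infinite_finite_induct) (simp_all add: soc_add)

lemma sum_in_soc: "(\<Sum>i\<in>I. u i * e * v i) \<in> soc"
  by (intro soc_sum soc_mult_right soc_mult_left e_in_soc)

lemma ideal_sum_representation: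
  assumes "finite \<J>" "\<forall>J\<in>\<J>. minimal_right_ideal J" "\<forall>J\<in>\<J>. g J \<in> J"
  shows "\<exists>u v. (\<Sum>J\<in>\<J>. g J) = (\<Sum>J\<in>\<J>. u J * e * v J)"
proof -
  have "\<exists>u v. g J = u * e * v" if "J \<in> \<J>" for J
    using minimal_right_ideal_element[of J "g J"] assms that by blast
  then obtain u v where "\<And>J. J \<in> \<J> \<Longrightarrow> g J = u J * e * v J" by metis
  then have "(\<Sum>J\<in>\<J>. g J) = (\<Sum>J\<in>\<J>. u J * e * v J)" by (intro sum.cong) auto
  then show ?thesis by blast
qed

lemma soc_representation:
  assumes "s \<in> soc"
  shows "\<exists>(I :: 'a set set) u v. finite I \<and> s = (\<Sum>i\<in>I. u i * e * v i)"
proof -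
  obtain F g where F: "finite F" "F \<subseteq> {J. minimal_right_ideal J}" "\<forall>J\<in>F. g J \<in> J" "s = (\<Sum>J\<in>F. g J)"
    using assms unfolding soc_def ideal_sum_def by blast
  then show ?thesis using ideal_sum_representation[of F g] by blast
qed

text \<open>Gaussian elimination: a linear relation between the \<open>e * v i\<close> makes
  \<open>u' k\<close> vanish and changes neither the element nor its prospective trace. It drives
  the well-definedness of \<open>tr\<close>, the regularity of the socle and the computation of
  ranks.\<close>

lemma eliminate_term:
  fixes I :: "'i set" and u v :: "'i \<Rightarrow> 'a" and c :: "'i \<Rightarrow> complex"
  assumes I: "finite I" "k \<in> I" and dep: "(\<Sum>i\<in>I. c i *\<^sub>C (e * v i)) = 0" and ck: "c k \<noteq> 0"
  defines "u' \<equiv> \<lambda>i. u i - (c i / c k) *\<^sub>C u k"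
  shows "(\<Sum>i\<in>I. u i * e * v i) = (\<Sum>i\<in>I - {k}. u' i * e * v i)"
    and "(\<Sum>i\<in>I. \<phi> (v i * u i)) = (\<Sum>i\<in>I - {k}. \<phi> (v i * u' i))"
proof -
  have "(\<Sum>i\<in>I. u i * e * v i) - (\<Sum>i\<in>I. u' i * e * v i) = (\<Sum>i\<in>I. (c i / c k) *\<^sub>C (u k * e * v i))"
    unfolding sum_subtractf[symmetric] by (simp add: u'_def left_diff_distrib mult_scaleC_left)
  also have "\<dots> = (\<Sum>i\<in>I. (1 / c k) *\<^sub>C (u k * (c i *\<^sub>C (e * v i))))"
    by (intro sum.cong) (simp_all add: mult_scaleC_right scaleC_scaleC mult.assoc)
  also have "\<dots> = (1 / c k) *\<^sub>C (u k * (\<Sum>i\<in>I. c i *\<^sub>C (e * v i)))"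
    by (simp add: complex_vector.scale_sum_right sum_distrib_left)
  finally have "(\<Sum>i\<in>I. u i * e * v i) = (\<Sum>i\<in>I. u' i * e * v i)" by (simp add: dep)
  then show "(\<Sum>i\<in>I. u i * e * v i) = (\<Sum>i\<in>I - {k}. u' i * e * v i)"
    using ck by (simp add: sum.remove[OF I] u'_def scaleC_one)
  have "(\<Sum>i\<in>I. c i * \<phi> (v i * u k)) *\<^sub>C e = (\<Sum>i\<in>I. c i *\<^sub>C (e * (v i * u k) * e))"
    by (simp add: corner scaleC_scaleC complex_vector.scale_sum_left)
  also have "\<dots> = (\<Sum>i\<in>I. c i *\<^sub>C (e * v i)) * u k * e"
    by (simp add: sum_distrib_right mult_scaleC_left mult.assoc)
  finally have z: "(\<Sum>i\<in>I. c i * \<phi> (v i * u k)) = 0" using nonzero by (simp add: dep)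
  have "(\<Sum>i\<in>I. \<phi> (v i * u i)) - (\<Sum>i\<in>I. \<phi> (v i * u' i)) = (\<Sum>i\<in>I. c i * \<phi> (v i * u k)) / c k"
    unfolding sum_subtractf[symmetric]
    by (simp add: u'_def right_diff_distrib mult_scaleC_right phi_diff phi_scale sum_divide_distrib)
  then have "(\<Sum>i\<in>I. \<phi> (v i * u i)) = (\<Sum>i\<in>I. \<phi> (v i * u' i))" by (simp add: z)
  then show "(\<Sum>i\<in>I. \<phi> (v i * u i)) = (\<Sum>i\<in>I - {k}. \<phi> (v i * u' i))"
    using ck by (simp add: sum.remove[OF I] u'_def scaleC_one)
qed

text \<open>If some \<open>u k * e\<close> is nonzero, multiplying the zero sum from the left by a
  suitable \<open>e * w\<close> gives a relation between the \<open>e * v i\<close> with nonzero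
  coefficient at \<open>k\<close>, and one term can be eliminated. If there is none, every summand
  of the trace vanishes.\<close>

lemma trace_well_defined:
  fixes I :: "'i set"
  assumes "finite I" "(\<Sum>i\<in>I. u i * e * v i) = 0"
  shows "(\<Sum>i\<in>I. \<phi> (v i * u i)) = 0"
  using assms
proof (induction "card I" arbitrary: I u)
  case (Suc n)
  show ?case
  proof (cases "\<forall>k\<in>I. u k * e = 0")
    case True
    have "\<phi> (v i * u i) = 0" if "i \<in> I" for i
      by (rule phi_eqI) (use True that in \<open>simp add: mult.assoc\<close>)
    then show ?thesis by simp
  next
    case False
    then obtain k where k: "k \<in> I" "u k * e \<noteq> 0" by blast
    obtain w where w: "e * w * (u k * e) \<noteq> 0" using primeD[of e "u k * e"] nonzero k(2) by blast
    have c: "\<phi> (w * u k) \<noteq> 0" using w corner[of "w * u k"] by (auto simp: mult.assoc)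
    have "(\<Sum>i\<in>I. \<phi> (w * u i) *\<^sub>C (e * v i)) = (\<Sum>i\<in>I. e * (w * u i) * e * v i)"
      unfolding corner by (simp add: mult_scaleC_left)
    also have "\<dots> = e * w * (\<Sum>i\<in>I. u i * e * v i)" by (simp add: sum_distrib_left mult.assoc)
    finally have dep: "(\<Sum>i\<in>I. \<phi> (w * u i) *\<^sub>C (e * v i)) = 0" using Suc.prems by simp
    note el = eliminate_term[OF Suc.prems(1) k(1) dep c]
    show ?thesis unfolding el(2)
      by (rule Suc.hyps(1)) (use Suc el(1) k(1) in auto)
  qed
qed simp

text \<open>The index type is \<open>'a set\<close> because \<open>soc_representation\<close>
  indexes the terms by minimal right ideals; \<open>tr_eq\<close> admits every other type.\<close>

definition tr :: "'a \<Rightarrow> complex" where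
  "tr s = (SOME t. \<exists>(I :: 'a set set) u v.
     finite I \<and> s = (\<Sum>i\<in>I. u i * e * v i) \<and> t = (\<Sum>i\<in>I. \<phi> (v i * u i)))"

lemma tr_eq:
  fixes I :: "'i set"
  assumes I: "finite I"
  shows "tr (\<Sum>i\<in>I. u i * e * v i) = (\<Sum>i\<in>I. \<phi> (v i * u i))"
proof -
  define s where "s = (\<Sum>i\<in>I. u i * e * v i)"
  have "\<exists>t. \<exists>(I :: 'a set set) u v. finite I \<and> s = (\<Sum>i\<in>I. u i * e * v i) \<and> t = (\<Sum>i\<in>I. \<phi> (v i * u i))"
    using soc_representation[of s] sum_in_soc unfolding s_def by blast
  from someI_ex[OF this] obtain J :: "'a set set" and u' v' where
    J: "finite J" "s = (\<Sum>i\<in>J. u' i * e * v' i)" "tr s = (\<Sum>i\<in>J. \<phi> (v' i * u' i))"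
    unfolding tr_def by blast
  \<comment> \<open>The difference of the two representations, over the disjoint union of the index
    sets, represents \<open>0\<close>.\<close>
  define U where "U = case_sum u u'"
  define V where "V = case_sum v (\<lambda>i. - v' i)"
  have "(\<Sum>i\<in>I <+> J. U i * e * V i) = 0"
    using I J by (simp add: sum.Plus U_def V_def s_def sum_negf)
  then have "(\<Sum>i\<in>I <+> J. \<phi> (V i * U i)) = 0"
    by (rule trace_well_defined[rotated]) (use I J in simp)
  moreover have "\<phi> (- x) = - \<phi> x" for x using phi_diff[of 0 x] by simp
  ultimately show ?thesis
    using I J by (simp add: sum.Plus U_def V_def s_def sum_negf)
qed

lemma tr_add:
  assumes "s \<in> soc" "t \<in> soc"
  shows "tr (s + t) = tr s + tr t"
proof -
  obtain I :: "'a set set" and u v where I: "finite I" "s = (\<Sum>i\<in>I. u i * e * v i)"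
    using soc_representation[OF assms(1)] by blast
  obtain J :: "'a set set" and u' v' where J: "finite J" "t = (\<Sum>i\<in>J. u' i * e * v' i)"
    using soc_representation[OF assms(2)] by blast
  define U where "U = case_sum u u'"
  define V where "V = case_sum v v'"
  have "s + t = (\<Sum>i\<in>I <+> J. U i * e * V i)"
    using I J by (simp add: sum.Plus U_def V_def)
  then have "tr (s + t) = (\<Sum>i\<in>I <+> J. \<phi> (V i * U i))" using tr_eq[of "I <+> J" U V] I J by simp
  then show ?thesis using I J by (simp add: sum.Plus U_def V_def tr_eq)
qed

lemma tr_scale:
  assumes "s \<in> soc"
  shows "tr (c *\<^sub>C s) = c * tr s"
proof -
  obtain I :: "'a set set" and u v where I: "finite I" "s = (\<Sum>i\<in>I. u i * e * v i)"
    using soc_representation[OF assms(1)] by blast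
  have "c *\<^sub>C s = (\<Sum>i\<in>I. (c *\<^sub>C u i) * e * v i)"
    by (simp add: I complex_vector.scale_sum_right mult_scaleC_left)
  then show ?thesis
    using tr_eq[OF I(1), of "\<lambda>i. c *\<^sub>C u i" v] tr_eq[OF I(1), of u v] I(2)
    by (simp add: mult_scaleC_right phi_scale sum_distrib_left)
qed

lemma tr_zero [simp]: "tr 0 = 0"
  using tr_eq[of "{} :: nat set"] by simp

lemma tr_diff: "s \<in> soc \<Longrightarrow> t \<in> soc \<Longrightarrow> tr (s - t) = tr s - tr t"
  using tr_add[of "s - t" t] soc_add[of s "- t"] soc_minus[of t] by simp

lemma tr_sum: "(\<And>i. i \<in> I \<Longrightarrow> f i \<in> soc) \<Longrightarrow> tr (\<Sum>i\<in>I. f i) = (\<Sum>i\<in>I. tr (f i))"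
  by (induction I rule: infinite_finite_induct) (simp_all add: tr_add soc_sum)

lemma tr_commute:
  assumes "s \<in> soc"
  shows "tr (s * a) = tr (a * s)"
proof -
  obtain I :: "'a set set" and u v where I: "finite I" "s = (\<Sum>i\<in>I. u i * e * v i)"
    using soc_representation[OF assms(1)] by blast
  have "s * a = (\<Sum>i\<in>I. u i * e * (v i * a))" "a * s = (\<Sum>i\<in>I. (a * u i) * e * v i)"
    by (simp_all add: I sum_distrib_left sum_distrib_right mult.assoc)
  then show ?thesis
    using tr_eq[OF I(1), of u "\<lambda>i. v i * a"] tr_eq[OF I(1), of "\<lambda>i. a * u i" v] by (simp add: mult.assoc)
qed

text \<open>Induction on the number of terms of \<open>s\<close>: subtracting \<open>s x e y s\<close>, normalised by
  \<open>e y s x e = e\<close>, lowers it by one, and \<open>s\<close> is regular if \<open>s - s x e y s\<close> is.\<close>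

lemma soc_regular_aux:
  fixes I :: "'i set" and s :: 'a
  assumes "finite I" "s = (\<Sum>i\<in>I. u i * e * v i)"
  shows "\<exists>t. s * t * s = s"
  using assms
proof (induction "card I" arbitrary: I s u v)
  case 0
  then show ?case by auto
next
  case (Suc n)
  show ?case
  proof (cases "s = 0")
    case False
    obtain y where y: "e * y * s \<noteq> 0" using primeD[of e s] False nonzero by blast
    obtain x0 where x0: "e * y * s * x0 * e \<noteq> 0" using primeD[of "e * y * s" e] y nonzero by blast
    define x where "x = (1 / \<phi> (y * s * x0)) *\<^sub>C x0"
    have eq: "e * y * s * x0 * e = \<phi> (y * s * x0) *\<^sub>C e"
      using corner[of "y * s * x0"] by (simp add: mult.assoc)
    then have nz: "\<phi> (y * s * x0) \<noteq> 0" using x0 by auto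
    then have yx: "e * y * s * x * e = e"
      using eq by (simp add: x_def mult_scaleC_left mult_scaleC_right scaleC_scaleC scaleC_one)
    define w where "w = x * e * y"
    define v' where "v' i = v i * (1 - w * s)" for i
    have s': "s - s * w * s = (\<Sum>i\<in>I. u i * e * v' i)"
      unfolding v'_def mult.assoc[symmetric] sum_distrib_right[symmetric] Suc.prems(2)[symmetric]
      by (simp add: right_diff_distrib mult.assoc)
    \<comment> \<open>Splitting the nonzero \<open>e * y * s * x * e\<close> along the terms of
      \<open>s\<close> finds an index \<open>k\<close> whose coefficient in the relation
      \<open>dep\<close> is nonzero. That relation holds because \<open>e * y\<close> annihilates
      \<open>s - s * w * s\<close>.\<close>
    have "(\<Sum>i\<in>I. (\<phi> (y * u i) * \<phi> (v i * x)) *\<^sub>C e) = (\<Sum>i\<in>I. e * (y * u i * e * (v i * x)) * e)"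
      by (simp add: corner phi_mult)
    also have "\<dots> = e * y * s * x * e"
      unfolding Suc.prems(2) by (simp add: sum_distrib_left sum_distrib_right mult.assoc)
    finally have "(\<Sum>i\<in>I. (\<phi> (y * u i) * \<phi> (v i * x)) *\<^sub>C e) \<noteq> 0" using yx nonzero by simp
    then obtain k where k: "k \<in> I" "(\<phi> (y * u k) * \<phi> (v k * x)) *\<^sub>C e \<noteq> 0"
      by (meson sum.neutral)
    then have ck: "\<phi> (y * u k) \<noteq> 0" by auto
    have "(\<Sum>i\<in>I. \<phi> (y * u i) *\<^sub>C (e * v' i)) = (\<Sum>i\<in>I. e * (y * u i) * e * v' i)"
      unfolding corner by (simp add: mult_scaleC_left)
    also have "\<dots> = e * y * (s - s * w * s)" unfolding s' by (simp add: sum_distrib_left mult.assoc)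
    also have "\<dots> = e * y * s - (e * y * s * x * e) * y * s"
      by (simp add: w_def right_diff_distrib mult.assoc)
    finally have dep: "(\<Sum>i\<in>I. \<phi> (y * u i) *\<^sub>C (e * v' i)) = 0" by (simp add: yx)
    note el = eliminate_term(1)[OF Suc.prems(1) k(1) dep ck]
    have "\<exists>t. (s - s * w * s) * t * (s - s * w * s) = s - s * w * s"
      by (rule Suc.hyps(1)[OF _ _ s'[unfolded el]]) (use Suc k(1) in auto)
    then obtain t where t: "(s - s * w * s) * t * (s - s * w * s) = s - s * w * s" by blast
    \<comment> \<open>McCoy's lemma: an inner inverse of \<open>s - s * w * s\<close> yields one of
      \<open>s\<close>.\<close>
    have "s * (w + (1 - w * s) * t * (1 - s * w)) * s
        = s * w * s + (s - s * w * s) * t * (s - s * w * s)"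
      by (simp add: algebra_simps)
    then show ?thesis using t by (intro exI) simp
  qed auto
qed

lemma soc_regular: "(s :: 'a) \<in> soc \<Longrightarrow> \<exists>t. s * t * s = s"
  using soc_representation[of s] soc_regular_aux by blast

text \<open>With \<open>s t s = s\<close> we have \<open>tr s = tr (t s\<^sup>2)\<close>, and \<open>(t s\<^sup>2)^n = t s^(n+1)\<close>.\<close>

lemma tr_nilpotent:
  assumes "s \<in> soc" "s ^ n = 0"
  shows "tr s = 0"
  using assms
proof (induction n arbitrary: s)
  case (Suc n)
  show ?case
  proof (cases "n = 0")
    case False
    obtain t where t: "s * t * s = s" using soc_regular Suc.prems by blast
    have pow: "(t * s * s) ^ Suc m = t * s ^ Suc (Suc m)" for m
    proof (induction m)
      case (Suc m)
      have "(t * s * s) ^ Suc (Suc m) = t * s * (s * t * s) * s ^ Suc m"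
        by (subst power_Suc, subst Suc) (simp add: mult.assoc)
      then show ?case unfolding t by (simp add: mult.assoc)
    qed (simp add: mult.assoc)
    obtain m where m: "n = Suc m" using False by (cases n) auto
    have "tr (t * s * s) = 0"
      by (rule Suc.IH) (use Suc.prems pow[of m] m in \<open>auto intro: soc_mult_left\<close>)
    moreover have "tr s = tr (s * (t * s))" by (simp add: t mult.assoc[symmetric])
    moreover have "\<dots> = tr (t * s * s)" by (rule tr_commute) (rule Suc.prems)
    ultimately show ?thesis by simp
  qed (use Suc.prems in simp)
qed simp

text \<open>In a shortest representation of \<open>p\<close>, with \<open>n\<close> terms, the
  \<open>e * v i\<close> are independent, and this forces \<open>\<phi> (v j * u j) = 1\<close>, so
  \<open>tr p = n\<close>. A family of minimal right ideals with sum \<open>p A\<close> gives a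
  representation with as many terms, and a shortest representation gives such a family of at most
  \<open>n\<close> ideals.\<close>

lemma idempotent_rank_eq_tr:
  assumes p: "p \<in> soc" "p * p = p"
  shows "of_nat (idempotent_rank p) = tr p"
proof -
  define P where "P n \<longleftrightarrow> (\<exists>(I :: 'a set set) u v. finite I \<and> card I = n \<and> p = (\<Sum>i\<in>I. u i * e * v i))" for n
  define Q where "Q n \<longleftrightarrow> (\<exists>\<J>. finite \<J> \<and> card \<J> = n \<and> (\<forall>J\<in>\<J>. minimal_right_ideal J) \<and>
        ideal_sum \<J> = range (\<lambda>x. p * x))" for n
  define n where "n = (LEAST n. P n)"
  have "\<exists>n. P n" using soc_representation[OF p(1)] unfolding P_def by blast
  then have "P n" unfolding n_def by (rule LeastI_ex)
  then obtain I :: "'a set set" and u v0 where I: "finite I" "card I = n" "p = (\<Sum>i\<in>I. u i * e * v0 i)"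
    unfolding P_def by blast
  define v where "v i = v0 i * p" for i
  have vp: "v i * p = v i" for i by (simp add: v_def mult.assoc p(2))
  have pv: "p = (\<Sum>i\<in>I. u i * e * v i)"
    using arg_cong[OF I(3), of "\<lambda>x. x * p"] by (simp add: p(2) sum_distrib_right v_def mult.assoc)
  have indep: "c k = 0" if "k \<in> I" "(\<Sum>i\<in>I. c i *\<^sub>C (e * v i)) = 0" for c k
  proof (rule ccontr)
    assume "c k \<noteq> 0"
    from eliminate_term(1)[OF I(1) that(1) that(2) this, of u]
    have "p = (\<Sum>i\<in>I - {k}. (u i - (c i / c k) *\<^sub>C u k) * e * v i)" using pv by simp
    then have "P (card (I - {k}))"
      unfolding P_def using I(1)
      by (intro exI[of _ "I - {k}"] exI[of _ "\<lambda>i. u i - (c i / c k) *\<^sub>C u k"] exI[of _ v]) simp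
    then have "n \<le> card (I - {k})" unfolding n_def by (rule Least_le)
    moreover have "card (I - {k}) < card I" by (rule card_Diff1_less[OF I(1) that(1)])
    ultimately show False using I(2) by simp
  qed
  have "\<phi> (v j * u j) = 1" if j: "j \<in> I" for j
  proof -
    \<comment> \<open>Expand \<open>p\<close> in \<open>e * v j * p = e * v j\<close> and compare
      coefficients: the matrix of the \<open>\<phi> (v j * u i)\<close> is the identity.\<close>
    have "(\<Sum>i\<in>I. \<phi> (v j * u i) *\<^sub>C (e * v i)) = (\<Sum>i\<in>I. e * (v j * u i) * e * v i)"
      unfolding corner by (simp add: mult_scaleC_left)
    also have "\<dots> = e * v j * p" by (subst pv) (simp add: sum_distrib_left mult.assoc)
    also have "\<dots> = (\<Sum>i\<in>I. (if i = j then 1 else 0) *\<^sub>C (e * v i))"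
      using I(1) j by (simp add: if_distrib[of "\<lambda>c. c *\<^sub>C _"] scaleC_one mult.assoc vp cong: if_cong)
    finally have "(\<Sum>i\<in>I. (\<phi> (v j * u i) - (if i = j then 1 else 0)) *\<^sub>C (e * v i)) = 0"
      by (simp only: complex_vector.scale_left_diff_distrib sum_subtractf) simp
    from indep[OF j this] show ?thesis by simp
  qed
  then have tr: "tr p = of_nat n" using tr_eq[OF I(1), of u v] pv I(2) by simp
  have QP: "P m" if "Q m" for m
  proof -
    obtain \<J> where J: "finite \<J>" "card \<J> = m" "\<forall>J\<in>\<J>. minimal_right_ideal J"
        "ideal_sum \<J> = range (\<lambda>x. p * x)" using \<open>Q m\<close> unfolding Q_def by blast
    have "p * 1 \<in> ideal_sum \<J>" unfolding J by (rule rangeI)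
    then obtain F g where F: "finite F" "F \<subseteq> \<J>" "\<forall>J\<in>F. g J \<in> J" "p = (\<Sum>J\<in>F. g J)"
      unfolding ideal_sum_def by auto
    \<comment> \<open>The sum for \<open>p\<close> may use a subfamily \<open>F\<close> only;
      padding with zeros gives exactly \<open>m\<close> terms.\<close>
    define h where "h J = (if J \<in> F then g J else 0)" for J
    have "p = (\<Sum>J\<in>\<J>. h J)" unfolding F(4) h_def using F J(1)
      by (intro sum.mono_neutral_cong_left) auto
    moreover have "\<forall>J\<in>\<J>. h J \<in> J"
      using J(3) F(3) unfolding h_def minimal_right_ideal_def right_ideal_def by auto
    ultimately show "P m"
      using ideal_sum_representation[OF J(1,3)] J(1,2) unfolding P_def by metis
  qed
  have "\<exists>m\<le>n. Q m"
  proof -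
    \<comment> \<open>Terms with \<open>p * u i * e = 0\<close> generate no minimal ideal, and a
      priori two indices may generate the same one, so at first the family has at most
      \<open>n\<close> members. Equality comes from \<open>QP\<close>.\<close>
    define \<J> where "\<J> = (\<lambda>i. range (\<lambda>y. p * u i * e * y)) ` {i\<in>I. p * u i * e \<noteq> 0}"
    have fin: "finite \<J>" unfolding \<J>_def using I(1) by simp
    have "card \<J> \<le> card {i\<in>I. p * u i * e \<noteq> 0}" unfolding \<J>_def using I(1) by (intro card_image_le) simp
    also have "\<dots> \<le> n" using I(1,2) by (auto intro: card_mono)
    finally have cn: "card \<J> \<le> n" .
    have min: "\<forall>J\<in>\<J>. minimal_right_ideal J"
      unfolding \<J>_def using minimal_right_ideal_translate_e by auto
    then have ri: "\<And>J. J \<in> \<J> \<Longrightarrow> right_ideal J" unfolding minimal_right_ideal_def by blast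
    have "ideal_sum \<J> = range (\<lambda>x. p * x)"
    proof
      show "ideal_sum \<J> \<subseteq> range (\<lambda>x. p * x)"
      proof
        fix z assume "z \<in> ideal_sum \<J>"
        then obtain F g where F: "F \<subseteq> \<J>" "\<forall>J\<in>F. g J \<in> J" "z = (\<Sum>J\<in>F. g J)"
          unfolding ideal_sum_def by blast
        have "p * g J = g J" if "J \<in> F" for J
        proof -
          have "J \<in> \<J>" "g J \<in> J" using F that by auto
          then obtain i y where "g J = p * u i * e * y" unfolding \<J>_def by auto
          then show ?thesis using p(2) by (simp add: mult.assoc[symmetric])
        qed
        then have "p * z = z" unfolding F(3) sum_distrib_left by (intro sum.cong) auto
        then show "z \<in> range (\<lambda>x. p * x)" by (metis rangeI)
      qed
      show "range (\<lambda>x. p * x) \<subseteq> ideal_sum \<J>"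
      proof clarify
        fix x
        have "p * u i * e * (v i * x) \<in> ideal_sum \<J>" if "i \<in> I" for i
        proof (cases "p * u i * e = 0")
          case True
          then show ?thesis by (simp add: zero_in_ideal_sum)
        next
          case False
          then have "range (\<lambda>y. p * u i * e * y) \<in> \<J>" using that unfolding \<J>_def by blast
          then show ?thesis by (rule in_ideal_sum) (rule rangeI)
        qed
        with I(1) have "(\<Sum>i\<in>I. p * u i * e * (v i * x)) \<in> ideal_sum \<J>"
          by (induction I rule: finite_induct) (simp_all add: zero_in_ideal_sum ideal_sum_add[OF ri])
        moreover have "(\<Sum>i\<in>I. p * u i * e * (v i * x)) = p * (\<Sum>i\<in>I. u i * e * v i) * x"
          by (simp add: sum_distrib_left sum_distrib_right mult.assoc)
        ultimately show "p * x \<in> ideal_sum \<J>" using pv p(2) by simp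
      qed
    qed
    then show ?thesis using fin cn min unfolding Q_def by blast
  qed
  then obtain m where m: "m \<le> n" "Q m" by blast
  have "idempotent_rank p = (LEAST n. Q n)" unfolding idempotent_rank_def Q_def ..
  moreover have "P (LEAST n. Q n)" by (rule QP, rule LeastI, rule m(2))
  then have "n \<le> (LEAST n. Q n)" unfolding n_def by (rule Least_le)
  moreover have "(LEAST n. Q n) \<le> m" by (rule Least_le, rule m(2))
  ultimately show ?thesis using tr m(1) by simp
qed

end

section \<open>Riesz idempotents of algebraic elements\<close>

definition aeval :: "'a::complex_banach_algebra_1 \<Rightarrow> complex poly \<Rightarrow> 'a" where
  "aeval a p = fold_coeffs (\<lambda>c y. c *\<^sub>C 1 + a * y) p 0"

lemma aeval_0 [simp]: "aeval a 0 = 0"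
  by (simp add: aeval_def)

lemma aeval_pCons [simp]: "aeval a (pCons c p) = c *\<^sub>C 1 + a * aeval a p"
  by (cases "p = 0 \<and> c = 0") (auto simp: aeval_def)

lemma aeval_1 [simp]: "aeval a 1 = 1"
  by (simp add: one_pCons scaleC_one)

lemma aeval_add: "aeval a (p + q) = aeval a p + aeval a q"
  by (induction p q rule: poly_induct2) (simp_all add: scaleC_add_left distrib_left)

lemma aeval_smult: "aeval a (smult c p) = c *\<^sub>C aeval a p"
  by (induction p) (simp_all add: scaleC_add_right scaleC_scaleC mult_scaleC_right)

lemma aeval_mult: "aeval a (p * q) = aeval a p * aeval a q"
  by (induction p)
     (simp_all add: aeval_add aeval_smult distrib_right mult_scaleC_left mult.assoc)

lemma aeval_sum: "aeval a (\<Sum>i\<in>I. f i) = (\<Sum>i\<in>I. aeval a (f i))"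
  by (induction I rule: infinite_finite_induct) (simp_all add: aeval_add)

lemma aeval_power: "aeval a (p ^ n) = aeval a p ^ n"
  by (induction n) (simp_all add: aeval_mult)

lemma aeval_monom: "aeval a (monom c n) = c *\<^sub>C a ^ n"
  by (induction n) (simp_all add: monom_0 monom_Suc mult_scaleC_right)

lemma aeval_dvd: "q dvd p \<Longrightarrow> aeval a q = 0 \<Longrightarrow> aeval a p = 0"
  by (auto simp: aeval_mult elim: dvdE)

lemma aeval_linear: "aeval a [:- z, 1:] = a - z *\<^sub>C 1"
  by (simp add: scaleC_one complex_vector.scale_minus_left)

lemma aeval_commute: "a * aeval a p = aeval a p * a"
proof -
  have "aeval a [:0, 1:] = a" by (simp add: scaleC_one)
  then show ?thesis by (metis aeval_mult mult.commute)
qed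

section \<open>Partial fractions for powers of linear factors\<close>

definition comaximal :: "'r::comm_ring_1 \<Rightarrow> 'r \<Rightarrow> bool" where
  "comaximal a b \<longleftrightarrow> (\<exists>u v. u * a + v * b = 1)"

lemma comaximal_commute: "comaximal a b \<Longrightarrow> comaximal b a"
  unfolding comaximal_def by (metis add.commute)

lemma comaximal_mult:
  assumes "comaximal a b" "comaximal a c"
  shows "comaximal a (b * c)"
proof -
  obtain u v u' v' where *: "u * a + v * b = 1" "u' * a + v' * c = 1"
    using assms unfolding comaximal_def by blast
  have "(u * u' * a + u * v' * c + v * b * u') * a + (v * v') * (b * c) =
     (u * a + v * b) * (u' * a + v' * c)" by (simp add: algebra_simps)
  then show ?thesis unfolding comaximal_def * by (metis mult_1)
qed

lemma comaximal_1: "comaximal a 1"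
  unfolding comaximal_def by (rule exI[of _ 0], rule exI[of _ 1]) simp

lemma comaximal_power: "comaximal a b \<Longrightarrow> comaximal a (b ^ n)"
  by (induction n) (simp_all add: comaximal_1 comaximal_mult)

lemma comaximal_prod: "(\<And>i. i \<in> I \<Longrightarrow> comaximal a (f i)) \<Longrightarrow> comaximal a (\<Prod>i\<in>I. f i)"
  by (induction I rule: infinite_finite_induct) (simp_all add: comaximal_1 comaximal_mult)

lemma comaximal_linear:
  fixes z w :: complex
  assumes "z \<noteq> w"
  shows "comaximal [:- z, 1:] [:- w, 1:]"
proof -
  have "w / (w - z) - z / (w - z) = 1" using assms by (simp flip: diff_divide_distrib)
  then have "[:1 / (w - z):] * [:- z, 1:] + [:- (1 / (w - z)):] * [:- w, 1:] = 1"
    by (simp add: one_pCons)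
  then show ?thesis unfolding comaximal_def by blast
qed

text \<open>Evaluated at an algebraic element, the summands become its spectral idempotents. In the
  induction the old relation is multiplied by \<open>u * [:- z, 1:] ^ m\<close>, which supplies the
  new factor to every old term, and \<open>v\<close> is the cofactor of the new term.\<close>

lemma partial_fractions:
  fixes S :: "complex set"
  assumes "finite S" "S \<noteq> {}"
  shows "\<exists>c. (\<Sum>z\<in>S. c z * (\<Prod>w\<in>S - {z}. [:- w, 1:] ^ m)) = 1"
  using assms
proof (induction S rule: finite_ne_induct)
  case (singleton z)
  show ?case by (rule exI[of _ "\<lambda>_. 1"]) simp
next
  case (insert z S)
  obtain c where c: "(\<Sum>z\<in>S. c z * (\<Prod>w\<in>S - {z}. [:- w, 1:] ^ m)) = 1" using insert.IH by blast
  have "comaximal ([:- z, 1:] ^ m) (\<Prod>w\<in>S. [:- w, 1:] ^ m)"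
  proof (intro comaximal_prod comaximal_power)
    fix w assume "w \<in> S"
    then have "comaximal [:- w, 1:] [:- z, 1:]" using insert.hyps(3) by (intro comaximal_linear) auto
    then have "comaximal [:- w, 1:] ([:- z, 1:] ^ m)" by (rule comaximal_power)
    then show "comaximal ([:- z, 1:] ^ m) [:- w, 1:]" by (rule comaximal_commute)
  qed
  then obtain u v where uv: "u * [:- z, 1:] ^ m + v * (\<Prod>w\<in>S. [:- w, 1:] ^ m) = 1"
    unfolding comaximal_def by blast
  define c' where "c' x = (if x = z then v else u * c x)" for x
  have "(\<Sum>x\<in>S. c' x * (\<Prod>w\<in>insert z S - {x}. [:- w, 1:] ^ m)) =
      (\<Sum>x\<in>S. (u * [:- z, 1:] ^ m) * (c x * (\<Prod>w\<in>S - {x}. [:- w, 1:] ^ m)))"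
  proof (rule sum.cong)
    fix x assume x: "x \<in> S"
    then have "insert z S - {x} = insert z (S - {x})" using insert.hyps(3) by auto
    then show "c' x * (\<Prod>w\<in>insert z S - {x}. [:- w, 1:] ^ m) =
       (u * [:- z, 1:] ^ m) * (c x * (\<Prod>w\<in>S - {x}. [:- w, 1:] ^ m))"
      using x insert.hyps(1,3) by (auto simp: c'_def mult_ac)
  qed simp
  also have "\<dots> = u * [:- z, 1:] ^ m" by (simp only: sum_distrib_left[symmetric] c mult_1_right)
  finally have "(\<Sum>x\<in>insert z S. c' x * (\<Prod>w\<in>insert z S - {x}. [:- w, 1:] ^ m)) = 1"
    using insert.hyps(1,3) uv by (simp add: c'_def add.commute)
  then show ?case by blast
qed

lemma poly_dvd_linear_factors:
  fixes q :: "complex poly"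
  assumes "q \<noteq> 0"
  shows "\<exists>S m. finite S \<and> q dvd (\<Prod>z\<in>S. [:- z, 1:]) ^ m"
  using assms
proof (induction "degree q" arbitrary: q)
  case 0
  then have "q dvd 1" by (metis is_unit_iff_degree)
  then show ?case by (intro exI[of _ "{}"]) auto
next
  case (Suc n)
  have "\<not> constant (poly q)" using Suc.hyps(2) by (simp add: constant_degree)
  then obtain z where "poly q z = 0" using fundamental_theorem_of_algebra by blast
  then obtain r where r: "q = [:- z, 1:] * r" by (metis dvdE poly_eq_0_iff_dvd)
  have "r \<noteq> 0" using r Suc.prems by auto
  then have "degree q = Suc (degree r)" unfolding r by (subst degree_mult_eq) auto
  then obtain S m where S: "finite S" "r dvd (\<Prod>z\<in>S. [:- z, 1:]) ^ m"
    using Suc.hyps(1)[of r] Suc.hyps(2) \<open>r \<noteq> 0\<close> by auto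
  have "(\<Prod>z\<in>S. [:- z, 1:]) dvd (\<Prod>z\<in>insert z S. [:- z, 1:])"
    using S(1) by (intro prod_dvd_prod_subset) auto
  then have "r dvd (\<Prod>z\<in>insert z S. [:- z, 1:]) ^ m"
    using S(2) dvd_power_same dvd_trans by blast
  moreover have "[:- z, 1:] dvd (\<Prod>z\<in>insert z S. [:- z, 1:])"
    by (rule dvd_prodI) (use S(1) in auto)
  ultimately have "q dvd (\<Prod>z\<in>insert z S. [:- z, 1:]) ^ Suc m"
    unfolding r power_Suc by (rule mult_dvd_mono[rotated])
  then show ?case using S(1) by blast
qed

text \<open>One \<open>m\<close> serves all points, and \<open>p_nonzero\<close> makes
  \<open>S\<close> the exact spectrum.\<close>

locale spectral_resolution =
  fixes a :: "'a::complex_banach_algebra_1" and S :: "complex set" and p :: "complex \<Rightarrow> 'a" and m :: nat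
  assumes finite_S: "finite S"
    and p_nonzero: "z \<in> S \<Longrightarrow> p z \<noteq> 0"
    and p_commute: "z \<in> S \<Longrightarrow> a * p z = p z * a"
    and p_nilpotent: "z \<in> S \<Longrightarrow> (a - z *\<^sub>C 1) ^ m * p z = 0"
    and p_orthogonal: "z \<in> S \<Longrightarrow> w \<in> S \<Longrightarrow> z \<noteq> w \<Longrightarrow> p z * p w = 0"
    and p_sum: "(\<Sum>z\<in>S. p z) = 1"

text \<open>The product of two different partial fraction terms is divisible by \<open>F\<close>,
  which annihilates \<open>a\<close>; this gives orthogonality.\<close>

lemma algebraic_spectral_resolution:
  fixes a :: "'a::complex_banach_algebra_1"
  assumes "q \<noteq> 0" "aeval a q = 0"
  shows "\<exists>S p m. spectral_resolution a S p m"
proof -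
  obtain S m where S: "finite S" "q dvd (\<Prod>z\<in>S. [:- z, 1:]) ^ m"
    using poly_dvd_linear_factors[OF assms(1)] by blast
  define Q where "Q z = (\<Prod>w\<in>S - {z}. [:- w, 1:] ^ m)" for z
  define F where "F = (\<Prod>w\<in>S. [:- w, 1:] ^ m)"
  have F0: "aeval a F = 0"
    using aeval_dvd[OF S(2) assms(2)] by (simp add: F_def prod_power_distrib)
  \<comment> \<open>For empty \<open>S\<close> the polynomial \<open>F\<close> would be
    \<open>1\<close>, which does not annihilate \<open>a\<close>.\<close>
  have "S \<noteq> {}" using F0 by (auto simp: F_def)
  then obtain c where c: "(\<Sum>z\<in>S. c z * Q z) = 1"
    using partial_fractions[OF S(1), of m] unfolding Q_def by blast
  define p where "p z = aeval a (c z * Q z)" for z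
  have FQ: "F = [:- z, 1:] ^ m * Q z" if "z \<in> S" for z
    unfolding F_def Q_def using S(1) that by (simp add: prod.remove)
  have p1: "(\<Sum>z\<in>S. p z) = 1" unfolding p_def aeval_sum[symmetric] c by simp
  have p2: "(a - z *\<^sub>C 1) ^ m * p z = 0" if "z \<in> S" for z
  proof -
    have "(a - z *\<^sub>C 1) ^ m * p z = aeval a ([:- z, 1:] ^ m * (c z * Q z))"
      by (simp add: p_def aeval_mult aeval_power aeval_linear)
    also have "[:- z, 1:] ^ m * (c z * Q z) = c z * F" by (simp add: FQ[OF that])
    finally show ?thesis by (simp add: aeval_mult F0)
  qed
  have p3: "p z * p w = 0" if "z \<in> S" "w \<in> S" "z \<noteq> w" for z w
  proof -
    have "[:- z, 1:] ^ m dvd Q w" unfolding Q_def by (rule dvd_prodI) (use S(1) that in auto)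
    then have "F dvd (c z * Q z) * (c w * Q w)"
      unfolding FQ[OF that(1)] mult.commute[of "[:- z, 1:] ^ m"] by (intro mult_dvd_mono dvd_triv_right dvd_mult)
    from aeval_dvd[OF this F0] show ?thesis unfolding p_def by (simp only: aeval_mult)
  qed
  \<comment> \<open>A root of \<open>q\<close> outside the spectrum has \<open>p z = 0\<close> and
    is dropped.\<close>
  have "spectral_resolution a {z\<in>S. p z \<noteq> 0} p m"
  proof
    show "(\<Sum>z\<in>{z\<in>S. p z \<noteq> 0}. p z) = 1"
      unfolding p1[symmetric] using S(1) by (intro sum.mono_neutral_left) auto
  qed (use S(1) p2 p3 in \<open>auto simp: p_def aeval_commute\<close>)
  then show ?thesis by blast
qed

lemma bounded_linear_scaleC_left: "bounded_linear (\<lambda>c. c *\<^sub>C (x :: 'a::complex_banach_algebra_1))"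
proof (rule bounded_linear_intro)
  show "(r *\<^sub>R c) *\<^sub>C x = r *\<^sub>R (c *\<^sub>C x)" for r c
    by (simp only: scaleR_conv_of_real[of r c] scaleC_of_real[symmetric] scaleC_scaleC)
  show "norm (c *\<^sub>C x) \<le> norm c * norm x" for c by (simp add: norm_scaleC)
qed (rule scaleC_add_left)

text \<open>At the centre this is Cauchy's formula for the derivatives of the constant
  \<open>1\<close>; for \<open>w\<close> outside the closed disc the integrand is holomorphic on
  it.\<close>

lemma contour_integral_inverse_power_circle:
  assumes "r > 0" "w = z \<or> w \<notin> cball z r"
  shows "((\<lambda>u. 1 / (u - w) ^ Suc k) has_contour_integral
     (if w = z \<and> k = 0 then 2 * complex_of_real pi * \<i> else 0)) (circlepath z r)"
proof (cases "w = z")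
  case True
  have "((\<lambda>u. 1 / (u - z) ^ Suc k) has_contour_integral
      ((2 * pi * \<i>) / (fact k) * (deriv ^^ k) (\<lambda>_. 1) z)) (circlepath z r)"
    by (rule Cauchy_has_contour_integral_higher_derivative_circlepath) (use assms in auto)
  then show ?thesis using True by (cases k) (auto simp: higher_deriv_const)
next
  case False
  then have w: "w \<notin> cball z r" using assms(2) by blast
  have "((\<lambda>u. 1 / (u - w) ^ Suc k) has_contour_integral 0) (circlepath z r)"
  proof (rule Cauchy_theorem_convex_simple)
    show "(\<lambda>u. 1 / (u - w) ^ Suc k) holomorphic_on cball z r"
      using w by (intro holomorphic_intros) auto
    show "path_image (circlepath z r) \<subseteq> cball z r" using assms(1) by auto
  qed auto
  then show ?thesis using False by simp
qed

section \<open>Spectrum, resolvent and Riesz idempotents of an algebraic element\<close>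

context spectral_resolution
begin

lemma m_pos: "z \<in> S \<Longrightarrow> m > 0"
  using p_nonzero[of z] p_nilpotent[of z] by (cases m) auto

lemma p_idempotent:
  assumes "z \<in> S"
  shows "p z * p z = p z"
proof -
  have "p z = (\<Sum>w\<in>S. p z * p w)" using p_sum by (simp add: sum_distrib_left[symmetric])
  also have "\<dots> = (\<Sum>w\<in>{z}. p z * p w)"
    using assms by (intro sum.mono_neutral_right finite_S) (auto intro: p_orthogonal)
  finally show ?thesis by simp
qed

text \<open>On the range of \<open>p z\<close>, \<open>w - a\<close> is the scalar
  \<open>w - z\<close> minus a nilpotent, so its inverse is a finite geometric series.\<close>

definition resolvent_formula :: "complex \<Rightarrow> 'a" where
  "resolvent_formula w = (\<Sum>z\<in>S. \<Sum>k<m. (1 / (w - z) ^ Suc k) *\<^sub>C ((a - z *\<^sub>C 1) ^ k * p z))"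

lemma is_inverse_resolvent_formula:
  assumes "w \<notin> S"
  shows "is_inverse (w *\<^sub>C 1 - a) (resolvent_formula w)"
proof -
  have comm: "a * ((a - z *\<^sub>C 1) ^ k * p z) = ((a - z *\<^sub>C 1) ^ k * p z) * a" if "z \<in> S" for z k
  proof -
    have "(a - z *\<^sub>C 1) * a = a * (a - z *\<^sub>C 1)"
      by (simp add: left_diff_distrib right_diff_distrib mult_scaleC_left mult_scaleC_right)
    then have "(a - z *\<^sub>C 1) ^ k * a = a * (a - z *\<^sub>C 1) ^ k" by (rule power_commuting_commutes)
    then have "a * ((a - z *\<^sub>C 1) ^ k * p z) = (a - z *\<^sub>C 1) ^ k * (a * p z)"
      by (simp add: mult.assoc[symmetric])
    then show ?thesis using p_commute[OF that] by (simp add: mult.assoc)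
  qed
  have "a * resolvent_formula w = resolvent_formula w * a"
    unfolding resolvent_formula_def
    by (simp add: sum_distrib_left sum_distrib_right mult_scaleC_left mult_scaleC_right comm)
  then have c: "(w *\<^sub>C 1 - a) * resolvent_formula w = resolvent_formula w * (w *\<^sub>C 1 - a)"
    by (simp add: left_diff_distrib right_diff_distrib mult_scaleC_left mult_scaleC_right)
  have "(w *\<^sub>C 1 - a) * (\<Sum>k<m. (1 / (w - z) ^ Suc k) *\<^sub>C ((a - z *\<^sub>C 1) ^ k * p z)) = p z"
    if z: "z \<in> S" for z
  proof -
    define d where "d = a - z *\<^sub>C 1"
    have wz: "w - z \<noteq> 0" using z assms by auto
    have wa: "w *\<^sub>C 1 - a = (w - z) *\<^sub>C 1 - d" by (simp add: d_def complex_vector.scale_left_diff_distrib)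
    define T where "T k = (1 / (w - z) ^ k) *\<^sub>C (d ^ k * p z)" for k
    have "(w *\<^sub>C 1 - a) * (1 / (w - z) ^ Suc k) *\<^sub>C (d ^ k * p z) = T k - T (Suc k)" for k
      unfolding wa T_def left_diff_distrib using wz
      by (simp add: mult_scaleC_left mult_scaleC_right scaleC_scaleC mult.assoc)
    then have "(w *\<^sub>C 1 - a) * (\<Sum>k<m. (1 / (w - z) ^ Suc k) *\<^sub>C (d ^ k * p z)) = (\<Sum>k<m. T k - T (Suc k))"
      by (simp only: sum_distrib_left)
    also have "\<dots> = T 0 - T m" by (rule sum_lessThan_telescope')
    also have "\<dots> = p z" using p_nilpotent[OF z] by (simp add: T_def d_def scaleC_one)
    finally show ?thesis by (simp add: d_def)
  qed
  then have "(w *\<^sub>C 1 - a) * resolvent_formula w = 1"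
    unfolding resolvent_formula_def by (subst sum_distrib_left) (simp add: p_sum)
  then show ?thesis using c unfolding is_inverse_def by simp
qed

lemma spectrum_eq: "spectrum a = S"
proof
  show "spectrum a \<subseteq> S" unfolding spectrum_def using is_inverse_resolvent_formula by blast
  show "S \<subseteq> spectrum a"
  proof
    fix z assume z: "z \<in> S"
    have False if b: "is_inverse (z *\<^sub>C 1 - a) b" for b
    proof -
      have "(- b) * (a - z *\<^sub>C 1) = 1" "(a - z *\<^sub>C 1) * (- b) = 1"
        using b unfolding is_inverse_def by (simp_all add: left_diff_distrib right_diff_distrib)
      then have "(- b) ^ m * (a - z *\<^sub>C 1) ^ m = 1"
        using power_mult_commuting[of "- b" "a - z *\<^sub>C 1" m] by simp
      then have "p z = (- b) ^ m * ((a - z *\<^sub>C 1) ^ m * p z)" by (simp add: mult.assoc[symmetric])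
      then show False using p_nilpotent[OF z] p_nonzero[OF z] by simp
    qed
    then show "z \<in> spectrum a" unfolding spectrum_def by blast
  qed
qed

lemma resolvent_eq: "w \<notin> S \<Longrightarrow> resolvent a w = resolvent_formula w"
  unfolding resolvent_def
proof (rule the_equality)
  assume w: "w \<notin> S"
  show inv: "is_inverse (w *\<^sub>C 1 - a) (resolvent_formula w)"
    by (rule is_inverse_resolvent_formula[OF w])
  fix b assume b: "is_inverse (w *\<^sub>C 1 - a) b"
  have "b = b * ((w *\<^sub>C 1 - a) * resolvent_formula w)" using inv unfolding is_inverse_def by simp
  also have "\<dots> = resolvent_formula w" using b unfolding is_inverse_def by (simp add: mult.assoc[symmetric])
  finally show "b = resolvent_formula w" .
qed

text \<open>The resolvent combines fixed algebra elements with the scalar functions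
  \<open>1 / (u - w) ^ Suc k\<close>, of which only \<open>w = z\<close>, \<open>k = 0\<close> has a
  nonzero integral over the circle.\<close>

lemma riesz_idempotent_eq:
  assumes z: "z \<in> S"
  shows "riesz_idempotent z a = p z"
proof -
  define r where "r = riesz_radius z a"
  obtain d where d: "d > 0" "\<And>w. w \<in> S \<Longrightarrow> w \<noteq> z \<Longrightarrow> d \<le> dist z w"
    using finite_set_avoid[OF finite_S, of z] by blast
  \<comment> \<open>A witness for the choice in \<open>riesz_radius\<close>: half the distance bound
    keeps the other points off the closed disc.\<close>
  have "d / 2 > 0 \<and> spectrum a \<inter> cball z (d / 2) = {z}"
    using d z unfolding spectrum_eq by (force simp: dist_commute)
  then have "r > 0 \<and> spectrum a \<inter> cball z r = {z}"
    unfolding r_def riesz_radius_def by (rule someI)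
  then have r: "r > 0" "S \<inter> cball z r = {z}" by (auto simp: spectrum_eq)
  define \<gamma> where "\<gamma> = circlepath z r"
  define D where "D t = vector_derivative \<gamma> (at t within {0..1})" for t
  define c where "c w k = (if w = z \<and> k = (0::nat) then 2 * complex_of_real pi * \<i> else 0)" for w k
  define A where "A w k = (a - w *\<^sub>C 1) ^ k * p w" for w k
  have off: "\<gamma> t \<notin> S" if "t \<in> {0..1}" for t
  proof
    assume "\<gamma> t \<in> S"
    moreover have "\<gamma> t \<in> sphere z r"
    proof -
      have "\<gamma> t \<in> path_image \<gamma>" unfolding path_image_def using that by (rule imageI)
      then show ?thesis using r(1) by (simp add: \<gamma>_def)
    qed
    ultimately have "\<gamma> t \<in> S \<inter> cball z r" "dist z (\<gamma> t) = r" by simp_all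
    then show False unfolding r(2) using r(1) by simp
  qed
  define F where "F w k t = (1 / (\<gamma> t - w) ^ Suc k * D t) *\<^sub>C A w k" for w k t
  define G where "G w k = c w k *\<^sub>C A w k" for w k
  have F: "(F w k has_integral G w k) {0..1}" if w: "w \<in> S" for w k
  proof -
    have "w = z \<or> w \<notin> cball z r" using r(2) w by blast
    from contour_integral_inverse_power_circle[OF r(1) this]
    have "((\<lambda>u. 1 / (u - w) ^ Suc k) has_contour_integral c w k) \<gamma>"
      unfolding c_def \<gamma>_def .
    then have "((\<lambda>t. 1 / (\<gamma> t - w) ^ Suc k * D t) has_integral c w k) {0..1}"
      unfolding has_contour_integral_def D_def .
    from has_integral_linear[OF this bounded_linear_scaleC_left[of "A w k"]]
    show ?thesis unfolding F_def G_def o_def .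
  qed
  have "((\<lambda>t. \<Sum>w\<in>S. \<Sum>k<m. F w k t) has_integral (\<Sum>w\<in>S. \<Sum>k<m. G w k)) {0..1}"
    by (rule has_integral_sum[OF finite_S], rule has_integral_sum[OF finite_lessThan], rule F)
  moreover have "(\<Sum>w\<in>S. \<Sum>k<m. F w k t) = D t *\<^sub>C resolvent a (\<gamma> t)" if "t \<in> {0..1}" for t
    unfolding resolvent_eq[OF off[OF that]] resolvent_formula_def A_def F_def
    by (simp only: complex_vector.scale_sum_right scaleC_scaleC mult.commute)
  ultimately have "((\<lambda>t. D t *\<^sub>C resolvent a (\<gamma> t)) has_integral
      (\<Sum>w\<in>S. \<Sum>k<m. G w k)) {0..1}"
    by (rule has_integral_eq[rotated])
  then have "algebra_contour_integral \<gamma> (resolvent a) = (\<Sum>w\<in>S. \<Sum>k<m. G w k)"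
    unfolding algebra_contour_integral_def D_def by (rule integral_unique)
  also have "\<dots> = (\<Sum>w\<in>{z}. \<Sum>k<m. G w k)"
    using z by (intro sum.mono_neutral_right finite_S) (auto simp: G_def c_def)
  also have "\<dots> = (\<Sum>k<m. G z k)" by simp
  \<comment> \<open>\<open>m > 0\<close> ensures that the index \<open>0\<close> occurs in the
    sum.\<close>
  also have "\<dots> = (\<Sum>k\<in>{0}. G z k)"
    using m_pos[OF z] by (intro sum.mono_neutral_right) (auto simp: G_def c_def)
  also have "\<dots> = (2 * complex_of_real pi * \<i>) *\<^sub>C p z" by (simp add: G_def c_def A_def)
  finally show ?thesis
    unfolding riesz_idempotent_def r_def[symmetric] \<gamma>_def[symmetric]
    by (simp add: scaleC_scaleC scaleC_one)
qed

end

section \<open>The spectral trace agrees with the algebraic one\<close>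

context rank_one_idempotent
begin

text \<open>In \<open>s ^ (k + 2) = s * s ^ k * s\<close> the corner relation turns everything
  between the two outer factors into scalars, so these powers all lie in the span of the finitely
  many \<open>u i * e * v j\<close>.\<close>

lemma soc_algebraic:
  fixes s :: 'a
  assumes "s \<in> soc"
  shows "\<exists>q. q \<noteq> 0 \<and> aeval s q = 0"
proof -
  obtain I :: "'a set set" and u v where I: "finite I" "s = (\<Sum>i\<in>I. u i * e * v i)"
    using soc_representation[OF assms] by blast
  define B where "B = (\<lambda>(i, j). u i * e * v j) ` (I \<times> I)"
  have finB: "finite B" unfolding B_def using I(1) by simp
  define f where "f k = s ^ (k + 2)" for k
  have f: "f k \<in> complex_vector.span B" for k
  proof -
    have "f k = s * s ^ k * s" by (simp add: f_def power_Suc2 del: power_Suc) (simp add: power_Suc2[symmetric] mult.assoc)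
    also have "\<dots> = (\<Sum>j\<in>I. \<Sum>i\<in>I. u i * (e * (v i * s ^ k * u j) * e) * v j)"
      by (subst (1 3) I(2)) (simp add: sum_distrib_left sum_distrib_right mult.assoc)
    also have "\<dots> = (\<Sum>j\<in>I. \<Sum>i\<in>I. \<phi> (v i * s ^ k * u j) *\<^sub>C (u i * e * v j))"
      unfolding corner by (simp add: mult_scaleC_left mult_scaleC_right)
    also have "\<dots> \<in> complex_vector.span B"
      by (intro complex_vector.span_sum complex_vector.span_scale complex_vector.span_base) (auto simp: B_def)
    finally show ?thesis .
  qed
  show ?thesis
  \<comment> \<open>The dimension count needs distinct powers; two equal ones give an annihilating
    polynomial at once.\<close>
  proof (cases "inj f")
    case True
    define N where "N = card B"
    have "card (f ` {..N}) = Suc N" using True by (simp add: card_image inj_on_subset)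
    then have "complex_vector.dependent (f ` {..N})"
      using complex_vector.independent_span_bound[OF finB, of "f ` {..N}"] f by (auto simp: N_def)
    then obtain g where g: "\<exists>x\<in>f ` {..N}. g x \<noteq> 0" "(\<Sum>x\<in>f ` {..N}. g x *\<^sub>C x) = 0"
      using complex_vector.dependent_finite[of "f ` {..N}"] by auto
    obtain k where k: "k \<le> N" "g (f k) \<noteq> 0" using g(1) by auto
    define q where "q = (\<Sum>i\<le>N. monom (g (f i)) (i + 2))"
    have "aeval s q = (\<Sum>i\<le>N. g (f i) *\<^sub>C f i)"
      by (simp only: q_def aeval_sum aeval_monom f_def)
    also have "\<dots> = (\<Sum>x\<in>f ` {..N}. g x *\<^sub>C x)"
      using True by (simp add: sum.reindex inj_on_subset)
    finally have "aeval s q = (\<Sum>x\<in>f ` {..N}. g x *\<^sub>C x)" .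
    moreover have "coeff q (k + 2) = g (f k)"
      using k(1) by (simp add: q_def coeff_sum)
    ultimately show ?thesis using g(2) k(2) by (metis coeff_0)
  next
    case False
    then obtain i j where ij: "f i = f j" "i \<noteq> j" unfolding inj_def by blast
    define q where "q = monom (1::complex) (i + 2) + monom (- 1) (j + 2)"
    have "coeff q (i + 2) = 1" using ij(2) by (simp add: q_def)
    moreover have "aeval s q = 0"
      using ij(1) unfolding q_def aeval_add aeval_monom f_def[symmetric]
      by (simp add: scaleC_one complex_vector.scale_minus_left)
    ultimately show ?thesis by (metis coeff_0 zero_neq_one)
  qed
qed

lemma soc_scaleC: "(s :: 'a) \<in> soc \<Longrightarrow> c *\<^sub>C s \<in> soc"
  using soc_mult_right[of s "c *\<^sub>C 1"] by (simp add: mult_scaleC_right)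

lemma soc_diff: "(s :: 'a) \<in> soc \<Longrightarrow> t \<in> soc \<Longrightarrow> s - t \<in> soc"
  using soc_add[of s "- t"] soc_minus[of t] by simp

text \<open>On \<open>p z\<close> the element \<open>s\<close> is \<open>z\<close> plus a nilpotent
  \<open>d\<close>, and nilpotents have \<open>tr\<close> zero, so \<open>s * p z\<close>
  contributes \<open>z * tr (p z)\<close>. The idempotent at \<open>0\<close> may lie outside the
  socle, but there \<open>s * p z\<close> itself is nilpotent.\<close>

lemma trace_eq_tr:
  assumes s: "s \<in> soc"
  shows "trace s = tr s"
proof -
  obtain q where "q \<noteq> 0" "aeval s q = 0" using soc_algebraic[OF s] by blast
  then obtain S p m where "spectral_resolution s S p m" using algebraic_spectral_resolution by blast
  then interpret spectral_resolution s S p m .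
  have summand: "z * of_nat (multiplicity z s) = tr (s * p z)" if z: "z \<in> S" for z
  proof -
    define d where "d = s - z *\<^sub>C 1"
    have dp: "d * p z = p z * d"
      using p_commute[OF z] by (simp add: d_def left_diff_distrib right_diff_distrib mult_scaleC_left mult_scaleC_right)
    have pm: "p z ^ m = p z"
      using m_pos[OF z] by (induction m rule: nat_induct_non_zero) (simp_all add: p_idempotent[OF z])
    have nil: "(d * p z) ^ m = 0"
      unfolding power_mult_commuting[OF dp] pm unfolding d_def by (rule p_nilpotent[OF z])
    have sp: "s * p z = z *\<^sub>C p z + d * p z"
      by (simp add: d_def left_diff_distrib mult_scaleC_left)
    show ?thesis
    proof (cases "z = 0")
      case True
      have "tr (s * p z) = 0"
        using tr_nilpotent[OF soc_mult_right[OF s], of "p z" m] nil sp True by simp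
      then show ?thesis using True by simp
    next
      case False
      \<comment> \<open>Modulo the socle \<open>s\<close> is \<open>0\<close> and \<open>d\<close>
        is \<open>- z\<close>. At \<open>k = m\<close> the first term vanishes, which puts
        \<open>p z\<close> into the socle as \<open>z \<noteq> 0\<close>.\<close>
      have "d ^ k * p z - (- z) ^ k *\<^sub>C p z \<in> soc" for k
      proof (induction k)
        case (Suc k)
        have "d ^ Suc k * p z - (- z) ^ Suc k *\<^sub>C p z
           = s * (d ^ k * p z) + (- z) *\<^sub>C (d ^ k * p z - (- z) ^ k *\<^sub>C p z)"
          by (simp add: d_def left_diff_distrib mult_scaleC_left mult.assoc complex_vector.scale_right_diff_distrib scaleC_scaleC
             complex_vector.scale_minus_left)
        then show ?case using Suc s by (simp add: soc_diff soc_scaleC soc_mult_right)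
      qed (simp add: scaleC_one)
      from this[of m] have "(- z) ^ m *\<^sub>C p z \<in> soc"
        using p_nilpotent[OF z] soc_minus by (fastforce simp: d_def)
      from soc_scaleC[OF this, of "1 / (- z) ^ m"] have p: "p z \<in> soc"
        using False by (simp add: scaleC_scaleC scaleC_one)
      have "d * p z \<in> soc" using p by (rule soc_mult_left)
      then have "tr (s * p z) = z * tr (p z)"
        unfolding sp using p by (simp add: tr_add soc_scaleC tr_scale tr_nilpotent[OF _ nil])
      then show ?thesis
        unfolding multiplicity_def riesz_idempotent_eq[OF z] idempotent_rank_eq_tr[OF p p_idempotent[OF z]] by simp
    qed
  qed
  have "tr s = tr (\<Sum>z\<in>S. s * p z)" by (simp add: sum_distrib_left[symmetric] p_sum)
  also have "\<dots> = (\<Sum>z\<in>S. tr (s * p z))" by (rule tr_sum) (rule soc_mult_right[OF s])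
  finally show ?thesis unfolding trace_def spectrum_eq by (simp add: summand)
qed

end

section \<open>Commutators modulo the socle\<close>

lemma soc_proj_eq_iff: "soc_proj a = soc_proj b \<longleftrightarrow> a - b \<in> soc"
  by (simp add: soc_quot.abs_eq_iff soc_rel_def)

lemma soc_proj_add: "soc_proj (a + b) = soc_proj a + soc_proj b"
  by (simp add: plus_soc_quot.abs_eq)

lemma soc_proj_mult: "soc_proj (a * b) = soc_proj a * soc_proj b"
  by (simp add: times_soc_quot.abs_eq)

lemma soc_proj_uminus: "soc_proj (- a) = - soc_proj a"
  by (simp add: uminus_soc_quot.abs_eq)

lemma soc_proj_diff: "soc_proj (a - b) = soc_proj a - soc_proj b"
  by (simp add: minus_soc_quot.abs_eq)

lemma soc_proj_0: "soc_proj 0 = 0"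
  by (simp add: zero_soc_quot.abs_eq)

lemma soc_proj_1: "soc_proj 1 = 1"
  by (simp add: one_soc_quot.abs_eq)

lemma soc_proj_power: "soc_proj (a ^ n) = soc_proj a ^ n"
  by (induction n) (simp_all add: soc_proj_mult soc_proj_1)

lemma soc_proj_sum: "soc_proj (\<Sum>i\<in>I. f i) = (\<Sum>i\<in>I. soc_proj (f i))"
  by (induction I rule: infinite_finite_induct) (simp_all add: soc_proj_add soc_proj_0)

lemmas soc_proj_simps = soc_proj_add soc_proj_mult soc_proj_uminus soc_proj_diff soc_proj_0
  soc_proj_1 soc_proj_power soc_proj_sum

lemma soc_proj_surj: "\<exists>a. soc_proj a = q"
  by (metis Quotient3_abs_rep Quotient3_soc_quot)

definition comm_mod_soc :: "'a::ring_1 \<Rightarrow> 'a \<Rightarrow> bool" where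
  "comm_mod_soc g h \<longleftrightarrow> soc_proj g * soc_proj h = soc_proj h * soc_proj g"

lemma comm_mod_soc_iff: "comm_mod_soc g h \<longleftrightarrow> g * h - h * g \<in> soc"
  by (simp add: comm_mod_soc_def soc_proj_mult[symmetric] soc_proj_eq_iff)

lemma comm_mod_soc_refl: "comm_mod_soc g g"
  and comm_mod_soc_1: "comm_mod_soc 1 g" "comm_mod_soc g 1"
  by (simp_all add: comm_mod_soc_def soc_proj_1)

lemma comm_mod_soc_sym: "comm_mod_soc g h \<Longrightarrow> comm_mod_soc h g"
  by (simp add: comm_mod_soc_def)

lemma comm_mod_soc_mult_left: "comm_mod_soc a c \<Longrightarrow> comm_mod_soc b c \<Longrightarrow> comm_mod_soc (a * b) c"
  unfolding comm_mod_soc_def soc_proj_mult by (metis mult.assoc)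

lemma comm_mod_soc_mult_right: "comm_mod_soc c a \<Longrightarrow> comm_mod_soc c b \<Longrightarrow> comm_mod_soc c (a * b)"
  by (metis comm_mod_soc_mult_left comm_mod_soc_sym)

lemma comm_mod_soc_add_left: "comm_mod_soc a c \<Longrightarrow> comm_mod_soc b c \<Longrightarrow> comm_mod_soc (a + b) c"
  by (simp add: comm_mod_soc_def soc_proj_simps distrib_left distrib_right)

lemma comm_mod_soc_add_right: "comm_mod_soc c a \<Longrightarrow> comm_mod_soc c b \<Longrightarrow> comm_mod_soc c (a + b)"
  by (metis comm_mod_soc_add_left comm_mod_soc_sym)

lemma comm_mod_soc_diff_left: "comm_mod_soc a c \<Longrightarrow> comm_mod_soc b c \<Longrightarrow> comm_mod_soc (a - b) c"
  by (simp add: comm_mod_soc_def soc_proj_simps left_diff_distrib right_diff_distrib)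

lemma comm_mod_soc_diff_right: "comm_mod_soc c a \<Longrightarrow> comm_mod_soc c b \<Longrightarrow> comm_mod_soc c (a - b)"
  by (metis comm_mod_soc_diff_left comm_mod_soc_sym)

lemmas comm_mod_soc_intros = comm_mod_soc_refl comm_mod_soc_1 comm_mod_soc_mult_left
  comm_mod_soc_mult_right comm_mod_soc_add_left comm_mod_soc_add_right comm_mod_soc_diff_left
  comm_mod_soc_diff_right

context rank_one_idempotent
begin

text \<open>On elements that commute modulo the socle, \<open>\<lambda>g h. tr (g h - h g)\<close> is an alternating form that only
  depends on the classes modulo the socle and is a derivation in each variable: formally it is
  \<open>\<integral> g dh\<close> for a functional that vanishes on exact differentials. The index of \<open>x\<close> is the integral of
  \<open>- dx / x\<close>, and adding a nilpotent \<open>f\<close> changes this by the exact differential of \<open>- log (1 + f / x)\<close>.\<close>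

definition tau :: "'a \<Rightarrow> 'a \<Rightarrow> complex" where
  "tau g h = tr (g * h - h * g)"

lemma tau_swap:
  assumes "comm_mod_soc g h"
  shows "tau h g = - tau g h"
  using tr_diff[OF soc_0, of "g * h - h * g"] assms by (simp add: tau_def comm_mod_soc_iff)

lemma tau_soc: "s \<in> soc \<Longrightarrow> tau s h = 0"
  using tr_commute[of s h] by (simp add: tau_def tr_diff soc_mult_left soc_mult_right)

lemma tau_add:
  assumes "comm_mod_soc g h" "comm_mod_soc g' h"
  shows "tau (g + g') h = tau g h + tau g' h"
  using tr_add[of "g * h - h * g" "g' * h - h * g'"] assms
  by (simp add: tau_def comm_mod_soc_iff algebra_simps)

lemma tau_cong_left:
  assumes "soc_proj g = soc_proj g'" "comm_mod_soc g h"
  shows "tau g h = tau g' h"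
proof -
  have s: "g' - g \<in> soc" using assms(1) soc_proj_eq_iff[of g' g] by simp
  have "comm_mod_soc (g' - g) h"
    using s by (simp add: comm_mod_soc_iff soc_diff soc_mult_left soc_mult_right)
  then have "tau (g + (g' - g)) h = tau g h + tau (g' - g) h" by (rule tau_add[OF assms(2)])
  then show ?thesis using tau_soc[OF s] by simp
qed

lemma tau_cong_right:
  assumes "soc_proj h = soc_proj h'" "comm_mod_soc g h"
  shows "tau g h = tau g h'"
proof -
  have "comm_mod_soc g h'" using assms by (simp add: comm_mod_soc_def)
  then show ?thesis
    using tau_cong_left[OF assms(1), of g] assms(2) tau_swap[of h g] tau_swap[of h' g]
    by (simp add: comm_mod_soc_sym)
qed

text \<open>The Leibniz rule. The commutator identity is exact, and both commutators on its right
  lie in the socle, so \<open>tr\<close> may be split.\<close>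

lemma tau_mult_right:
  assumes "comm_mod_soc g h" "comm_mod_soc g k" "comm_mod_soc h k"
  shows "tau g (h * k) = tau (g * h) k + tau (k * g) h"
proof -
  have "comm_mod_soc (g * h) k" "comm_mod_soc (k * g) h"
    by (intro comm_mod_soc_intros assms comm_mod_soc_sym[OF assms(3)])+
  moreover have "g * (h * k) - h * k * g = (g * h * k - k * (g * h)) + (k * g * h - h * (k * g))"
    by (simp add: mult.assoc)
  ultimately show ?thesis unfolding tau_def comm_mod_soc_iff by (simp only: tr_add)
qed

text \<open>Leibniz for \<open>p * p\<close> gives \<open>tau g p = 2 * tau (g * p) p\<close> for
  every admissible \<open>g\<close>. With \<open>g * p\<close> in place of \<open>g\<close> this
  makes \<open>tau (g * p) p\<close> its own double.\<close>

lemma tau_idempotent: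
  assumes p: "soc_proj p * soc_proj p = soc_proj p" and g: "comm_mod_soc g p"
  shows "tau g p = 0"
proof -
  have pp: "soc_proj p = soc_proj (p * p)" using p by (simp add: soc_proj_mult)
  have *: "tau g p = 2 * tau (g * p) p" if g: "comm_mod_soc g p" for g
  proof -
    have "tau g p = tau g (p * p)" by (rule tau_cong_right[OF pp g])
    also have "\<dots> = tau (g * p) p + tau (p * g) p"
      by (rule tau_mult_right[OF g g comm_mod_soc_refl])
    also have "tau (p * g) p = tau (g * p) p"
    proof (rule tau_cong_left)
      show "soc_proj (p * g) = soc_proj (g * p)" using g by (simp add: comm_mod_soc_def soc_proj_mult)
      show "comm_mod_soc (p * g) p" by (intro comm_mod_soc_intros g)
    qed
    finally show ?thesis by simp
  qed
  have gp: "comm_mod_soc (g * p) p" by (intro comm_mod_soc_intros g)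
  have "tau (g * p * p) p = tau (g * p) p"
  proof (rule tau_cong_left)
    show "soc_proj (g * p * p) = soc_proj (g * p)" using p by (simp add: soc_proj_mult mult.assoc)
    show "comm_mod_soc (g * p * p) p" by (intro comm_mod_soc_intros g)
  qed
  then have "tau (g * p) p = 0" using *[OF gp] by simp
  then show ?thesis using *[OF g] by simp
qed

text \<open>Leibniz for \<open>y * g\<close> leaves \<open>tau (p + h) g\<close> and
  \<open>tau (g * (x + f)) y\<close>. The first vanishes since \<open>p\<close> is idempotent modulo
  the socle and \<open>g\<close> is a polynomial in \<open>h\<close>. In the second,
  \<open>(1 + h) * g = 1\<close> modulo the socle turns \<open>g * (x + f)\<close> into
  \<open>x + q * (g * f)\<close>.\<close>

lemma tau_add_nilpotent:
  assumes xy: "drazin_inverse (soc_proj x) (soc_proj y)"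
    and xf: "comm_mod_soc x f" and N: "soc_proj f ^ N = 0"
    and z: "soc_proj z = soc_proj y * (\<Sum>k<N. (- (soc_proj y * soc_proj f)) ^ k)"
  shows "tau (x + f) z = tau x y"
proof -
  define h p where "h = y * f" and "p = x * y"
  define g where "g = (\<Sum>k<N. (- h) ^ k)"
  define q where "q = 1 - p"
  let ?X = "soc_proj x" and ?Y = "soc_proj y" and ?F = "soc_proj f" and ?G = "soc_proj g"
  have XY: "?X * ?Y = ?Y * ?X" "?Y * ?X * ?Y = ?Y" using xy unfolding drazin_inverse_def by auto
  have XF: "?X * ?F = ?F * ?X" using xf by (simp add: comm_mod_soc_def)
  have YF: "?Y * ?F = ?F * ?Y" by (rule drazin_inverse_commutes[OF xy XF])
  have G: "?G = (\<Sum>k<N. (- (?Y * ?F)) ^ k)" by (simp add: g_def h_def soc_proj_simps)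
  have "(?Y * ?F) ^ N = 0" by (simp add: power_mult_commuting[OF YF] N)
  then have HG: "(1 + ?Y * ?F) * ?G = 1" unfolding G by (rule one_plus_mult_geometric_sum)
  have cxy: "comm_mod_soc x y" and cyf: "comm_mod_soc y f"
    using XY YF by (simp_all add: comm_mod_soc_def)
  note base = xf cxy cyf xf[THEN comm_mod_soc_sym] cxy[THEN comm_mod_soc_sym] cyf[THEN comm_mod_soc_sym]
  have gc: "comm_mod_soc g w" if "comm_mod_soc w h" for w
    unfolding comm_mod_soc_def G
    by (rule sum_power_commuting[symmetric]) (use that in \<open>simp add: comm_mod_soc_def h_def soc_proj_mult\<close>)
  have "comm_mod_soc g x" "comm_mod_soc g y" "comm_mod_soc g f"
    unfolding h_def by (intro gc comm_mod_soc_intros base, unfold h_def, intro comm_mod_soc_intros base)+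
  note base = base this this[THEN comm_mod_soc_sym]
  note ci = comm_mod_soc_intros base
  have "soc_proj p * soc_proj p = ?X * (?Y * ?X * ?Y)" by (simp add: p_def soc_proj_mult mult.assoc)
  then have pp: "soc_proj p * soc_proj p = soc_proj p" by (simp add: XY(2) p_def soc_proj_mult)
  have zy: "soc_proj z = soc_proj (y * g)" by (simp add: z G soc_proj_mult)
  have "comm_mod_soc (x + f) (y * g)" by (intro ci)
  then have "comm_mod_soc (x + f) z" by (simp add: comm_mod_soc_def zy)
  then have "tau (x + f) z = tau (x + f) (y * g)" by (rule tau_cong_right[OF zy])
  also have "\<dots> = tau ((x + f) * y) g + tau (g * (x + f)) y"
    by (rule tau_mult_right; intro ci)
  also have "tau ((x + f) * y) g = tau (p + h) g"
  proof (rule tau_cong_left)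
    show "soc_proj ((x + f) * y) = soc_proj (p + h)"
      by (simp add: p_def h_def soc_proj_simps distrib_right YF)
  qed (intro ci)
  also have "\<dots> = tau p g + tau h g"
    unfolding p_def h_def by (rule tau_add; intro ci)
  \<comment> \<open>\<open>g\<close> is a polynomial in \<open>h\<close> in the algebra itself, so
    this commutator is exactly zero.\<close>
  also have "tau h g = 0"
    unfolding tau_def g_def using sum_power_commuting[of h "- h" N] by simp
  also have "tau p g = 0"
  proof -
    have "comm_mod_soc g p" unfolding p_def by (intro ci)
    then show ?thesis using tau_idempotent[OF pp] tau_swap by simp
  qed
  also have "tau (g * (x + f)) y = tau (x + q * (g * f)) y"
  proof (rule tau_cong_left)
    have GX: "?G * ?X = ?X * ?G" "?G * ?F = ?F * ?G" using base by (simp_all add: comm_mod_soc_def)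
    have "?X * ((1 + ?Y * ?F) * ?G) = ?X" by (simp add: HG)
    then have "?X * ?G = ?X - ?X * ?Y * ?F * ?G" by (simp add: distrib_left distrib_right mult.assoc eq_diff_eq)
    then show "soc_proj (g * (x + f)) = soc_proj (x + q * (g * f))"
      by (simp add: q_def p_def soc_proj_simps distrib_left left_diff_distrib GX mult.assoc)
  qed (intro ci)
  also have "\<dots> = tau x y + tau (q * (g * f)) y"
    unfolding q_def p_def by (rule tau_add; intro ci)
  \<comment> \<open>Modulo the socle \<open>y = y * p\<close> and \<open>p * q = 0\<close>, so
    Leibniz leaves one term paired with the idempotent and one whose first argument lies in the
    socle.\<close>
  also have "tau (q * (g * f)) y = 0"
  proof -
    have c: "comm_mod_soc (q * (g * f)) y" "comm_mod_soc (q * (g * f)) p" "comm_mod_soc y p"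
        "comm_mod_soc (q * (g * f) * y) p"
      unfolding q_def p_def by (intro ci)+
    have yp: "soc_proj y = soc_proj (y * p)" using XY by (simp add: p_def soc_proj_mult mult.assoc)
    have "p * (q * (g * f)) - 0 \<in> soc"
      unfolding soc_proj_eq_iff[symmetric] using pp
      by (simp add: q_def soc_proj_simps mult.assoc[symmetric] right_diff_distrib)
    then have 0: "tau (p * (q * (g * f))) y = 0" using tau_soc by simp
    have "tau (q * (g * f)) y = tau (q * (g * f)) (y * p)" by (rule tau_cong_right[OF yp c(1)])
    also have "\<dots> = tau (q * (g * f) * y) p + tau (p * (q * (g * f))) y"
      by (rule tau_mult_right) (fact c)+
    finally show ?thesis using 0 tau_idempotent[OF pp c(4)] by simp
  qed
  finally show ?thesis by simp
qed

text \<open>The lift chosen in \<open>index\<close> has the same class as \<open>y\<close> by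
  uniqueness of the Drazin inverse, and \<open>tau\<close> sees only classes.\<close>

lemma index_eq_tau:
  assumes "drazin_inverse (soc_proj x) (soc_proj y)"
  shows "index x = tau x y"
proof -
  define b where "b = (SOME b. drazin_inverse (soc_proj x) (soc_proj b))"
  have b: "drazin_inverse (soc_proj x) (soc_proj b)" unfolding b_def by (rule someI) (rule assms)
  then have yb: "soc_proj b = soc_proj y" using assms by (rule drazin_inverse_unique)
  have c: "comm_mod_soc x b" using b by (simp add: comm_mod_soc_def drazin_inverse_def)
  have "index x = trace (x * b - b * x)" unfolding index_def b_def[symmetric] Let_def ..
  also have "\<dots> = tau x b" using c unfolding tau_def comm_mod_soc_iff by (rule trace_eq_tr)
  also have "\<dots> = tau x y" by (rule tau_cong_right[OF yb c])
  finally show ?thesis .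
qed

end

section \<open>Stability of B-Fredholm elements and of their index\<close>

lemma soc_nonzero_minimal_right_ideal:
  assumes "(soc :: 'a::ring_1 set) \<noteq> {0}"
  shows "\<exists>J :: 'a set. minimal_right_ideal J"
proof (rule ccontr)
  assume "\<nexists>J :: 'a set. minimal_right_ideal J"
  then have "{J :: 'a set. minimal_right_ideal J} = {}" by auto
  then have "(soc :: 'a set) = {0}" by (auto simp: soc_def ideal_sum_def)
  then show False using assms by contradiction
qed

theorem theorem5p3:
  fixes f x :: "'a::complex_banach_algebra_1"
  assumes "semiprime TYPE('a)"
    and "(soc :: 'a set) \<noteq> {0}"
    and "\<exists>n::nat. f ^ n \<in> soc"
    and "b_fredholm x"
    and "x * f = f * x"
  shows "b_fredholm (x + f) \<and>
    (primitive_algebra TYPE('a) TYPE('v::ab_group_add) \<longrightarrow> index (x + f) = index x)"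
proof -
  obtain N where "f ^ N \<in> soc" using assms(3) by blast
  then have N: "soc_proj f ^ N = 0"
    using soc_proj_eq_iff[of "f ^ N" 0] by (simp add: soc_proj_simps)
  obtain y where y: "drazin_inverse (soc_proj x) (soc_proj y)"
    using assms(4) soc_proj_surj unfolding b_fredholm_def drazin_invertible_def by metis
  have xf: "soc_proj x * soc_proj f = soc_proj f * soc_proj x"
    using assms(5) by (simp add: soc_proj_mult[symmetric])
  obtain z where z: "soc_proj z = soc_proj y * (\<Sum>k<N. (- (soc_proj y * soc_proj f)) ^ k)"
    using soc_proj_surj by blast
  have xz: "drazin_inverse (soc_proj (x + f)) (soc_proj z)"
    unfolding z soc_proj_add by (rule drazin_inverse_add_nilpotent[OF y xf N])
  have "index (x + f) = index x" if prim: "primitive_algebra TYPE('a) TYPE('v)"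
  proof -
    have prime: "prime_ring TYPE('a)" by (rule primitive_imp_prime[OF prim])
    obtain J :: "'a set" where J: "minimal_right_ideal J"
      using soc_nonzero_minimal_right_ideal[OF assms(2)] by blast
    obtain e where e: "e \<in> J" "e \<noteq> 0" "e * e = e"
      by (rule minimal_right_ideal_idempotent[OF prime J])
    obtain \<phi> where "\<And>z. e * z * e = \<phi> z *\<^sub>C e"
      using minimal_idempotent_corner[OF J e] by metis
    then interpret rank_one_idempotent e \<phi>
      using prime e by unfold_locales
    show ?thesis
      unfolding index_eq_tau[OF xz] index_eq_tau[OF y]
      by (rule tau_add_nilpotent[OF y _ N z]) (simp add: comm_mod_soc_def xf)
  qed
  then show ?thesis using xz unfolding b_fredholm_def drazin_invertible_def by blast
qed

end
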